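(* There exists a continuum $X=L\cup J\cup R$ belonging to the class $\mathcal{C}$, with $L$ and $R$ being disjoint arcs, such that $$\mathcal{M}(X)=\mathcal{M}(J)\sqcup\mathcal{M}(L)\sqcup\mathcal{M}(R)\sqcup\mathcal{M}^*(L;R).$$
   Context: A continuum is a nonempty compact connected metrizable space. An arc is a space homeomorphic to $[0,1]$. A ray is a space homeomorphic to $[0,\infty)$. A free interval in a space is an open subset homeomorphic to $(0,1)$. The class $\mathcal{C}$ consists of all continua $X$ that can be written as $X=L\cup J\cup R$, where $J$ is a free interval dense in $X$, and $L,R$ are (nowhere dense) locally connected continua (possibly singletons) disjoint from $J$ such that, for some rays $J_L,J_R$ with $J=J_L\cup J_R$, the set $L\cup J_L$ is a compactification of $J_L$ (with remainder $L$) and $R\cup J_R$ is a compactification of $J_R$ (with remainder $R$). Writing "$X=L\cup J\cup R$ belongs to $\mathcal{C}$" means that $L,J,R$ are as in this definition. A continuous map $g\colon M\to M$ of a nonempty compact metrizable space $M$ is minimal (and $(M,g)$ is a minimal dynamical system) if no nonempty proper closed subset $N\subseteq M$ satisfies $g(N)\subseteq N$. For a metrizable (not necessarily compact) space $Y$, $\mathcal{M}(Y)$ denotes the system of all (nonempty) compact sets $M\subseteq Y$ for which there is a continuous map $f\colon Y\to Y$ with $f(M)=M$ and $(M,f|_M)$ a minimal dynamical system. For disjoint metrizable spaces $Y,Z$, $\mathcal{M}^*(Y;Z)$ denotes the system of all $M\in\mathcal{M}(Y\sqcup Z)$ such that $M\cap Y$ and $M\cap Z$ have the same cardinality (here $Y\sqcup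 Z$ is the disjoint union; for disjoint compact $L,R\subseteq X$ it is the subspace $L\cup R$). The symbol $\sqcup$ between systems of sets denotes a union of pairwise disjoint systems. *)

theory Defs
  imports "HOL-Analysis.Analysis" "HOL-Library.Equipollence"
begin

text \<open>
  Spaces are subsets, with the subspace topology, of a type of class \<open>metric_space\<close>; metrizability
  is therefore implicit. Maps \<open>Y \<rightarrow> Y\<close> are total functions of which only the values on \<open>Y\<close> matter.
  Existence of a continuum is stated in \<open>nat \<Rightarrow> real\<close> (product topology), where every compact
  metrizable space embeds; all notions below are topological invariants.
\<close>

definition continuum :: "'a::metric_space set \<Rightarrow> bool" where
  "continuum X \<longleftrightarrow> X \<noteq> {} \<and> compact X \<and> connected X"

definition is_arc :: "'a::metric_space set \<Rightarrow> bool" where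
  "is_arc A \<longleftrightarrow> A homeomorphic {0..1::real}"

definition is_ray :: "'a::metric_space set \<Rightarrow> bool" where
  "is_ray A \<longleftrightarrow> A homeomorphic {0::real..}"

definition free_interval :: "'a::metric_space set \<Rightarrow> 'a set \<Rightarrow> bool" where
  "free_interval X J \<longleftrightarrow> openin (top_of_set X) J \<and> J homeomorphic {0<..<1::real}"

definition dense_in :: "'a::metric_space set \<Rightarrow> 'a set \<Rightarrow> bool" where
  "dense_in X A \<longleftrightarrow> A \<subseteq> X \<and> top_of_set X closure_of A = X"

definition nowhere_dense_in :: "'a::metric_space set \<Rightarrow> 'a set \<Rightarrow> bool" where
  "nowhere_dense_in X A \<longleftrightarrow>
     A \<subseteq> X \<and> top_of_set X interior_of (top_of_set X closure_of A) = {}"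

definition compactification_with_remainder ::
    "'a::metric_space set \<Rightarrow> 'a set \<Rightarrow> 'a set \<Rightarrow> bool" where
  "compactification_with_remainder K A B \<longleftrightarrow> compact K \<and> dense_in K A \<and> K - A = B"

definition class_C ::
    "'a::metric_space set \<Rightarrow> 'a set \<Rightarrow> 'a set \<Rightarrow> 'a set \<Rightarrow> bool" where
  "class_C X L J R \<longleftrightarrow>
     continuum X \<and> X = L \<union> J \<union> R \<and>
     free_interval X J \<and> dense_in X J \<and>
     continuum L \<and> locally connected L \<and> nowhere_dense_in X L \<and> disjnt L J \<and>
     continuum R \<and> locally connected R \<and> nowhere_dense_in X R \<and> disjnt R J \<and>
     (\<exists>J\<^sub>L J\<^sub>R. is_ray J\<^sub>L \<and> is_ray J\<^sub>R \<and> J = J\<^sub>L \<union> J\<^sub>R \<and>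
        compactification_with_remainder (L \<union> J\<^sub>L) J\<^sub>L L \<and>
        compactification_with_remainder (R \<union> J\<^sub>R) J\<^sub>R R)"

definition minimal_system :: "'a::metric_space set \<Rightarrow> ('a \<Rightarrow> 'a) \<Rightarrow> bool" where
  "minimal_system M g \<longleftrightarrow>
     M \<noteq> {} \<and> compact M \<and> continuous_on M g \<and> g ` M \<subseteq> M \<and>
     \<not> (\<exists>N. N \<noteq> {} \<and> N \<subset> M \<and> closedin (top_of_set M) N \<and> g ` N \<subseteq> N)"

definition minimal_sets :: "'a::metric_space set \<Rightarrow> 'a set set" where
  "minimal_sets Y =
     {M. M \<noteq> {} \<and> compact M \<and> M \<subseteq> Y \<and>
         (\<exists>f. continuous_on Y f \<and> f ` Y \<subseteq> Y \<and> f ` M = M \<and> minimal_system M f)}"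

text \<open>
  The topological sum of \<open>Y\<close> and \<open>Z\<close> is rendered by the subspace \<open>Y \<union> Z\<close>. This is correct
  when \<open>Y\<close> and \<open>Z\<close> are disjoint and both relatively open in \<open>Y \<union> Z\<close>, in particular when they
  are disjoint and compact.
\<close>

definition minimal_sets_star :: "'a::metric_space set \<Rightarrow> 'a set \<Rightarrow> 'a set set" where
  "minimal_sets_star Y Z = {M \<in> minimal_sets (Y \<union> Z). M \<inter> Y \<approx> M \<inter> Z}"

text \<open>
  The systems are given as a list, not as a set, so that two equal nonempty systems
  do not count as disjoint.
\<close>

definition is_disjoint_union :: "'a set \<Rightarrow> 'a set list \<Rightarrow> bool" where
  "is_disjoint_union S As \<longleftrightarrow> S = \<Union> (set As) \<and> sorted_wrt disjnt As"

end

(* X is the double topologist's sine curve: the graph over (-1,1) of a triangle wave which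
   oscillates ever faster towards both ends, together with its two limit arcs L and R. The path
   components of X are L, J and R, so a continuous self-map of X maps each of them into one of
   them; running through the possible patterns, a minimal set lies in J, in L or in R, or the
   map interchanges L and R and the set meets both, and then its two parts are images of each
   other. Minimal sets inside J, L or R are realised in X because these pieces are absolute
   extensors.
   Conversely, let f interchange L and R and let M be a minimal set of f. By the fixed point
   property f o f has a fixed point in L, so M contains neither arc and f may be changed off M to
   be surjective from each arc to the other. A surjective map g of [0,1] lifts through the
   triangle wave to a map of the line at bounded distance from the identity; this yields an
   extension over J which reverses the direction of the line. *)

theory Submission
  imports Defs
begin

section \<open>The condensing triangle wave\<close>

text \<open>The triangle wave of period 2, that is, the distance to the nearest even integer. In
  this form continuity and periodicity come directly from \<open>arccos\<close> and
  \<open>cos\<close>.\<close>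

definition tri :: "real \<Rightarrow> real" where
  "tri t = arccos (cos (pi * t)) / pi"

(* Division by 0 makes this 0 at the end points; only the values for |s| < 1 are meaningful. *)
definition unsquash :: "real \<Rightarrow> real" where
  "unsquash s = s / (1 - \<bar>s\<bar>)"

text \<open>The inverse homeomorphism from the line onto (-1,1). The gap 1 -
  |\<open>squash t\<close>| is exactly 1 / (1 + |t|), so a bounded displacement on the line becomes
  one of the order of the distance to the ends.\<close>

definition squash :: "real \<Rightarrow> real" where
  "squash t = t / (1 + \<bar>t\<bar>)"

definition wave :: "real \<Rightarrow> real" where
  "wave s = tri (unsquash s)"

lemma tri_bounds: "0 \<le> tri t" "tri t \<le> 1"
  unfolding tri_def by (simp_all add: arccos_lbound arccos_ubound)

lemma continuous_on_tri [continuous_intros]: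
  fixes f :: "'a::t2_space \<Rightarrow> real"
  assumes "continuous_on S f"
  shows "continuous_on S (\<lambda>x. tri (f x))"
proof -
  have "continuous_on S (\<lambda>x. cos (pi * f x))"
    by (intro continuous_on_cos continuous_on_mult_left assms)
  then show ?thesis
    unfolding tri_def by (auto intro!: continuous_on_divide continuous_on_arccos)
qed

lemma tri_id: "0 \<le> t \<Longrightarrow> t \<le> 1 \<Longrightarrow> tri t = t"
  unfolding tri_def by (simp add: arccos_cos)

lemma tri_minus [simp]: "tri (- t) = tri t"
  by (simp add: tri_def)

lemma tri_periodic: "tri (t + 2 * of_int m) = tri t"
proof -
  have "cos (pi * (t + 2 * of_int m)) = cos (pi * t)"
    using cos_int_2pin[of m] sin_int_2pin[of m]
    by (simp add: distrib_left cos_add mult.assoc mult.left_commute)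
  then show ?thesis by (simp add: tri_def)
qed

lemma tri_reflect: "tri (2 - t) = tri t"
  using tri_periodic[of "-t" 1] by (simp add: algebra_simps)

lemma continuous_on_unsquash [continuous_intros]:
  "continuous_on S f \<Longrightarrow> (\<And>x. x \<in> S \<Longrightarrow> \<bar>f x\<bar> < 1) \<Longrightarrow> continuous_on S (\<lambda>x. unsquash (f x))"
  unfolding unsquash_def by (intro continuous_intros) fastforce+

lemma continuous_on_squash [continuous_intros]:
  "continuous_on S f \<Longrightarrow> continuous_on S (\<lambda>x. squash (f x))"
  unfolding squash_def by (intro continuous_intros) (auto simp: add_nonneg_eq_0_iff)

lemma abs_squash_less: "\<bar>squash t\<bar> < 1"
  unfolding squash_def by (simp add: abs_divide divide_simps)

lemma unsquash_squash [simp]: "unsquash (squash t) = t"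
proof -
  have "1 - \<bar>squash t\<bar> = 1 / (1 + \<bar>t\<bar>)"
    by (simp add: squash_def abs_divide divide_simps add_nonneg_eq_0_iff)
  then show ?thesis
    by (simp add: unsquash_def) (simp add: squash_def add_nonneg_eq_0_iff)
qed

lemma squash_unsquash: "\<bar>s\<bar> < 1 \<Longrightarrow> squash (unsquash s) = s"
proof -
  assume s: "\<bar>s\<bar> < 1"
  then have "1 + \<bar>unsquash s\<bar> = 1 / (1 - \<bar>s\<bar>)"
    by (simp add: unsquash_def abs_divide divide_simps)
  then show ?thesis using s
    by (simp add: squash_def) (simp add: unsquash_def)
qed

lemma unsquash_minus: "unsquash (- s) = - unsquash s"
  by (simp add: unsquash_def)

lemma squash_minus: "squash (- s) = - squash s"
  by (simp add: squash_def)

lemma wave_minus [simp]: "wave (- s) = wave s"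
  by (simp add: wave_def unsquash_minus)

lemma wave_bounds: "0 \<le> wave s" "wave s \<le> 1"
  by (simp_all add: wave_def tri_bounds)

lemma continuous_on_wave [continuous_intros]:
  fixes f :: "'a::t2_space \<Rightarrow> real"
  shows "continuous_on S f \<Longrightarrow> (\<And>x. x \<in> S \<Longrightarrow> \<bar>f x\<bar> < 1) \<Longrightarrow> continuous_on S (\<lambda>x. wave (f x))"
  unfolding wave_def by (intro continuous_intros)

text \<open>The triangle wave has height y at -(2n + y) for every n, and these points tend to -1
  after squashing.\<close>

lemma wave_attains_near_minus_one:
  assumes "-1 < b" "0 \<le> y" "y \<le> 1"
  obtains s where "-1 < s" "s < b" "s < 0" "wave s = y"
proof -
  \<comment> \<open>With this minimum, s < -1 + e yields both s < b and s < 0.\<close>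
  define e where "e = min (b + 1) 1"
  have "e > 0" using assms by (simp add: e_def)
  then obtain n :: nat where n: "1 / real (Suc n) < e"
    using nat_approx_posE by blast
  define t where "t = 2 * real (Suc n) + y"
  define s where "s = squash (- t)"
  have t: "t > 0" using assms by (simp add: t_def)
  have "s = -1 + 1 / (1 + t)"
    using t by (simp add: s_def squash_def field_simps)
  moreover have "1 / (1 + t) \<le> 1 / real (Suc n)"
    using assms by (intro divide_left_mono) (auto simp: t_def)
  ultimately have "s < -1 + e" using n by simp
  moreover have "-1 < s" using abs_squash_less[of "- t"] unfolding s_def by linarith
  moreover have "wave s = y"
    using tri_periodic[of y "int (Suc n)"] tri_id[of y] assms tri_minus[of t]
    by (simp add: wave_def s_def t_def add.commute)
  ultimately show ?thesis using that[of s] by (simp add: e_def)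
qed

section \<open>Continuity at the ends of the interval, and paths near the limit arcs\<close>

text \<open>The bound makes b vanish at both ends and squeezes it to 0 there.\<close>

lemma continuous_on_vanishing_ends:
  fixes b :: "real \<Rightarrow> real"
  assumes b: "continuous_on {-1<..<1} b"
    and bound: "\<And>s. s \<in> {-1..1} \<Longrightarrow> \<bar>b s\<bar> \<le> C * (1 - \<bar>s\<bar>)"
  shows "continuous_on {-1..1} b"
proof -
  have "(b \<longlongrightarrow> b s) (at s within {-1..1})" if s: "s \<in> {-1..1}" for s
  proof (cases "\<bar>s\<bar> < 1")
    case True
    then have "s \<in> {-1<..<1}" by auto
    then have "isCont b s"
      using b continuous_on_eq_continuous_at[OF open_greaterThanLessThan, of "-1" 1 b] by blast
    then show ?thesis
      using continuous_at_imp_continuous_within continuous_within by blast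
  next
    case False
    then have s1: "\<bar>s\<bar> = 1" using s by auto
    with bound[OF s] have b0: "b s = 0" by simp
    have "((\<lambda>x. C * (1 - \<bar>x\<bar>)) \<longlongrightarrow> C * (1 - \<bar>s\<bar>)) (at s within {-1..1})"
      by (intro tendsto_intros)
    then have "((\<lambda>x. C * (1 - \<bar>x\<bar>)) \<longlongrightarrow> 0) (at s within {-1..1})"
      using s1 by simp
    then have "(b \<longlongrightarrow> 0) (at s within {-1..1})"
      by (rule Lim_null_comparison[rotated])
         (use bound in \<open>auto simp: eventually_at_filter intro!: always_eventually\<close>)
    then show ?thesis by (simp add: b0)
  qed
  then show ?thesis by (simp add: continuous_on_def)
qed

text \<open>The factor 1 - |s| damps the oscillation at the ends. This is what lets the double sine
  curve be written as the zero set of a continuous function on a closed rectangle.\<close>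

lemma continuous_on_damped_wave: "continuous_on {-1..1} (\<lambda>s. (1 - \<bar>s\<bar>) * wave s)"
proof (rule continuous_on_vanishing_ends[where C = 1])
  show "continuous_on {-1<..<1} (\<lambda>s. (1 - \<bar>s\<bar>) * wave s)"
    by (intro continuous_intros) auto
  show "\<bar>(1 - \<bar>s\<bar>) * wave s\<bar> \<le> 1 * (1 - \<bar>s\<bar>)" if "s \<in> {-1..1}" for s
    using that wave_bounds[of s] by (auto simp: abs_mult intro!: mult_left_le)
qed

text \<open>A path starting in the limit arc stays there: otherwise, right after it leaves the arc
  for the last time, its second coordinate takes both values 0 and 1.\<close>

lemma no_escape_from_limit:
  fixes p\<^sub>0 p\<^sub>1 :: "real \<Rightarrow> real"
  assumes c0: "continuous_on {0..1} p\<^sub>0" and c1: "continuous_on {0..1} p\<^sub>1"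
    and ge: "\<And>t. t \<in> {0..1} \<Longrightarrow> -1 \<le> p\<^sub>0 t"
    and wave: "\<And>t. t \<in> {0..1} \<Longrightarrow> \<bar>p\<^sub>0 t\<bar> < 1 \<Longrightarrow> p\<^sub>1 t = wave (p\<^sub>0 t)"
    and start: "p\<^sub>0 0 = -1" and t: "t \<in> {0..1}"
  shows "p\<^sub>0 t = -1"
proof (rule ccontr)
  assume ne: "p\<^sub>0 t \<noteq> -1"
  define Z where "Z = {s \<in> {0..t}. p\<^sub>0 s = -1}"
  have "continuous_on {0..t} p\<^sub>0" using c0 t continuous_on_subset by fastforce
  then have "closed Z"
    unfolding Z_def by (intro continuous_closed_preimage_constant) auto
  moreover have "bounded Z"
    by (rule bounded_subset[of "{0..t}"]) (auto simp: Z_def)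
  ultimately have "compact Z" by (simp add: compact_eq_bounded_closed)
  moreover have "0 \<in> Z" using start t by (simp add: Z_def)
  ultimately obtain c where c: "c \<in> Z" "\<And>s. s \<in> Z \<Longrightarrow> s \<le> c"
    using compact_attains_sup[of Z] by blast
  have c01: "0 \<le> c" "c < t" "t \<le> 1" "p\<^sub>0 c = -1"
    using c(1) ne t by (auto simp: Z_def less_le)
  obtain d where d: "d > 0" "\<And>x. x \<in> {0..1} \<Longrightarrow> dist x c < d \<Longrightarrow> dist (p\<^sub>1 x) (p\<^sub>1 c) < 1/2"
    proof -
    have "c \<in> {0..1}" using c01 by auto
    then have "\<exists>d>0. \<forall>x\<in>{0..1}. dist x c < d \<longrightarrow> dist (p\<^sub>1 x) (p\<^sub>1 c) < 1/2"
      using c1[unfolded continuous_on_iff] half_gt_zero[OF zero_less_one] by blast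
    then show ?thesis using that by blast
  qed
  define e where "e = min (c + d / 2) t"
  have e: "c < e" "e \<le> t" "e < c + d" using d(1) c01 by (auto simp: e_def min_def)
  have "e \<notin> Z" using c(2)[of e] e by auto
  then have "p\<^sub>0 e \<noteq> -1" using e c01 by (auto simp: Z_def)
  then have pe: "-1 < p\<^sub>0 e" using ge[of e] e c01 by force
  \<comment> \<open>Between the times c and e the first coordinate runs through all values from -1
    to \<open>p\<^sub>0 e\<close>, among them one where the wave has height y. So each y of [0,1]
    comes within 1/2 of \<open>p\<^sub>1 c\<close>, which is impossible for 0 and 1
    together.\<close>
  have hit: "dist y (p\<^sub>1 c) < 1/2" if y: "0 \<le> y" "y \<le> 1" for y
  proof -
    obtain s where s: "-1 < s" "s < p\<^sub>0 e" "s < 0" "wave s = y"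
      using wave_attains_near_minus_one[OF pe y] by metis
    have "continuous_on {c..e} p\<^sub>0" by (rule continuous_on_subset[OF c0]) (use e c01 in auto)
    then obtain x where x: "c \<le> x" "x \<le> e" "p\<^sub>0 x = s"
      using IVT'[of p\<^sub>0 c s e] s c01 e by auto
    have "x \<in> {0..1}" "dist x c < d" using x e c01 by (auto simp: dist_real_def)
    moreover from this(1) have "p\<^sub>1 x = y" using wave[of x] x s by auto
    ultimately show ?thesis using d(2)[of x] by simp
  qed
  from hit[of 0] hit[of 1] show False by (simp add: dist_real_def)
qed

text \<open>Together with \<open>one_plus_abs_unsquash\<close> this bounds the effect of a bounded
  displacement on the line by a multiple of 1 - |s|, as \<open>continuous_on_vanishing_ends\<close>
  requires.\<close>

lemma squash_diff_le: "\<bar>squash u - squash v\<bar> \<le> 2 * \<bar>u - v\<bar> / (1 + \<bar>v\<bar>)"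
proof -
  have pos: "1 + \<bar>u\<bar> > 0" "1 + \<bar>v\<bar> > 0" by auto
  have "squash u - squash v = (u * (1 + \<bar>v\<bar>) - v * (1 + \<bar>u\<bar>)) / ((1 + \<bar>u\<bar>) * (1 + \<bar>v\<bar>))"
    using pos by (simp add: squash_def divide_simps)
  then have *: "\<bar>squash u - squash v\<bar> = \<bar>u * (1 + \<bar>v\<bar>) - v * (1 + \<bar>u\<bar>)\<bar> / ((1 + \<bar>u\<bar>) * (1 + \<bar>v\<bar>))"
    using pos by (simp add: abs_mult)
  \<comment> \<open>Both terms of this splitting contain a difference bounded by |u - v| with a
    coefficient at most 1 + |u|, which cancels against the denominator.\<close>
  have "u * (1 + \<bar>v\<bar>) - v * (1 + \<bar>u\<bar>) = (u - v) * (1 + \<bar>u\<bar>) + u * (\<bar>v\<bar> - \<bar>u\<bar>)"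
    by (simp add: algebra_simps)
  also have "\<bar>\<dots>\<bar> \<le> \<bar>u - v\<bar> * (1 + \<bar>u\<bar>) + \<bar>u\<bar> * \<bar>u - v\<bar>"
    by (rule order.trans[OF abs_triangle_ineq], rule add_mono)
       (auto simp: abs_mult intro: mult_left_mono)
  also have "\<dots> \<le> 2 * \<bar>u - v\<bar> * (1 + \<bar>u\<bar>)"
    by (simp add: algebra_simps)
  finally have "\<bar>squash u - squash v\<bar> \<le> 2 * \<bar>u - v\<bar> * (1 + \<bar>u\<bar>) / ((1 + \<bar>u\<bar>) * (1 + \<bar>v\<bar>))"
    unfolding * using pos by (intro divide_right_mono) auto
  also have "\<dots> = 2 * \<bar>u - v\<bar> / (1 + \<bar>v\<bar>)" using pos by simp
  finally show ?thesis .
qed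

lemma one_plus_abs_unsquash: "\<bar>s\<bar> < 1 \<Longrightarrow> 1 / (1 + \<bar>unsquash s\<bar>) = 1 - \<bar>s\<bar>"
proof -
  assume s: "\<bar>s\<bar> < 1"
  then have "1 + \<bar>unsquash s\<bar> = 1 / (1 - \<bar>s\<bar>)"
    by (simp add: unsquash_def abs_divide divide_simps)
  then show ?thesis by simp
qed

section \<open>Minimal sets and lifting through the wave\<close>

lemma minimal_system_cong:
  assumes "\<And>x. x \<in> M \<Longrightarrow> f x = g x"
  shows "minimal_system M f \<longleftrightarrow> minimal_system M g"
proof -
  have "f ` N = g ` N" if "N \<subseteq> M" for N
    using assms that by (intro image_cong) auto
  moreover have "continuous_on M f \<longleftrightarrow> continuous_on M g"
    using assms by (intro continuous_on_cong) auto
  ultimately show ?thesis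
    unfolding minimal_system_def by (metis order_refl psubsetE)
qed

text \<open>The intersection of M and C is a nonempty closed invariant subset of M, hence all of M.
  Minimality is applied below in this form.\<close>

lemma minimal_system_subset_closed:
  assumes "minimal_system M f" "closed C" "M \<inter> C \<noteq> {}" "f ` (M \<inter> C) \<subseteq> C"
  shows "M \<subseteq> C"
proof (rule ccontr)
  assume "\<not> M \<subseteq> C"
  then have "M \<inter> C \<subset> M" by auto
  moreover have "closedin (top_of_set M) (M \<inter> C)"
    using assms(2) by (simp add: closedin_closed_Int)
  moreover have "f ` (M \<inter> C) \<subseteq> M \<inter> C"
    using assms(1,4) unfolding minimal_system_def by (simp add: image_subset_iff)
  moreover have "\<not> (\<exists>N. N \<noteq> {} \<and> N \<subset> M \<and> closedin (top_of_set M) N \<and> f ` N \<subseteq> N)"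
    using assms(1) unfolding minimal_system_def by simp
  ultimately show False using assms(3) by metis
qed

text \<open>The dynamics on M are those of f, the self-map of the space is g; this separation allows
  f to be replaced off M.\<close>

lemma minimal_setsI:
  assumes "minimal_system M f" "f ` M = M" "M \<subseteq> Y" "continuous_on Y g" "g ` Y \<subseteq> Y"
    and "\<And>x. x \<in> M \<Longrightarrow> g x = f x"
  shows "M \<in> minimal_sets Y"
proof -
  have "minimal_system M g" using assms(1,6) minimal_system_cong by metis
  moreover have "g ` M = M" using assms(2,6) by (metis image_cong)
  ultimately show ?thesis
    using assms(3-5) unfolding minimal_sets_def minimal_system_def by blast
qed

lemma minimal_setsE:
  assumes "M \<in> minimal_sets Y"
  obtains f where "continuous_on Y f" "f ` Y \<subseteq> Y" "f ` M = M" "minimal_system M f"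
    "M \<noteq> {}" "compact M" "M \<subseteq> Y"
  using assms unfolding minimal_sets_def by blast

text \<open>Only f on M matters, and it takes values in M, hence in C. Read in the convex set I it
  extends to all of Y by Dugundji's theorem, and the homeomorphism brings the extension back into C.
  Since Z is arbitrary, membership can be moved from a piece to the whole space and
  conversely.\<close>

lemma minimal_sets_interval:
  fixes C Y Z M :: "'a::{metric_space,second_countable_topology} set" and I :: "real set"
  assumes "C homeomorphic I" "convex I" "M \<subseteq> C" "C \<subseteq> Y" "M \<in> minimal_sets Z"
  shows "M \<in> minimal_sets Y"
proof -
  obtain f where f: "continuous_on Z f" "f ` M = M" "minimal_system M f"
    and M: "M \<noteq> {}" "compact M" "M \<subseteq> Z"
    using assms(5) by (elim minimal_setsE)
  obtain \<phi> \<psi> where "homeomorphism C I \<phi> \<psi>"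
    using assms(1) unfolding homeomorphic_def by blast
  then have h: "continuous_on C \<phi>" "continuous_on I \<psi>" "\<And>x. x \<in> C \<Longrightarrow> \<phi> x \<in> I"
    "\<And>y. y \<in> I \<Longrightarrow> \<psi> y \<in> C" "\<And>x. x \<in> C \<Longrightarrow> \<psi> (\<phi> x) = x"
    unfolding homeomorphism_def by auto
  have fC: "f x \<in> C" if "x \<in> M" for x
    using that f(2) assms(3) by auto
  have "continuous_on M (\<lambda>x. \<phi> (f x))"
    by (rule continuous_on_compose2[OF h(1)])
       (use fC continuous_on_subset[OF f(1) M(3)] in auto)
  moreover have im: "(\<lambda>x. \<phi> (f x)) ` M \<subseteq> I" using h(3) fC by auto
  moreover have "I \<noteq> {}" using im M(1) by auto
  moreover have "closedin (top_of_set Y) M"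
    using M(2) assms(3,4) by (intro closed_subset compact_imp_closed) auto
  ultimately obtain g where g: "continuous_on Y g" "g ` Y \<subseteq> I"
    "\<And>x. x \<in> M \<Longrightarrow> g x = \<phi> (f x)"
    using Dugundji[OF assms(2), of Y M "\<lambda>x. \<phi> (f x)"] by metis
  show ?thesis
  proof (rule minimal_setsI[OF f(3,2)])
    show "M \<subseteq> Y" using assms(3,4) by (rule subset_trans)
    show "continuous_on Y (\<lambda>x. \<psi> (g x))"
      by (rule continuous_on_compose2[OF h(2) g(1,2)])
    show "(\<lambda>x. \<psi> (g x)) ` Y \<subseteq> Y"
      using h(4) g(2) assms(4) by (auto simp: image_subset_iff)
    show "\<psi> (g x) = f x" if "x \<in> M" for x
      using that h(5) g(3) fC by simp
  qed
qed

text \<open>The square of f maps the arc C into itself and so has a fixed point x there. If C lay in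
  M, the closed invariant set {x, f x} would contain M, and the arc would be finite.\<close>

lemma minimal_not_superset_arc:
  fixes C D :: "'a::metric_space set"
  assumes arc: "C homeomorphic {0..1::real}" and f: "continuous_on (C \<union> D) f"
    and fC: "f ` C \<subseteq> D" and fD: "f ` D \<subseteq> C" and M: "minimal_system M f"
  shows "\<not> C \<subseteq> M"
proof
  assume CM: "C \<subseteq> M"
  have "\<exists>x\<in>{0..1::real}. g x = x" if "continuous_on {0..1} g \<and> g \<in> {0..1} \<rightarrow> {0..1}" for g
    using that brouwer[of "{0..1::real}" g] by (metis compact_Icc convex_real_interval(5) atLeastatMost_empty_iff not_one_less_zero zero_le_one not_less)
  then have fp: "\<forall>g. continuous_on C g \<and> g \<in> C \<rightarrow> C \<longrightarrow> (\<exists>x\<in>C. g x = x)"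
    using homeomorphic_fixpoint_property[OF arc] by blast
  have "continuous_on C (\<lambda>x. f (f x))"
    by (rule continuous_on_compose2[of "C \<union> D" f])
       (use f fC in \<open>auto intro: continuous_on_subset\<close>)
  moreover have "(\<lambda>x. f (f x)) \<in> C \<rightarrow> C" using fC fD by blast
  ultimately obtain x where x: "x \<in> C" "f (f x) = x"
    using fp by blast
  have "M \<subseteq> {x, f x}"
    by (rule minimal_system_subset_closed[OF M]) (use x CM in auto)
  then have "finite C" using CM by (meson finite.emptyI finite.insertI finite_subset)
  then have "finite {0..1::real}"
    using arc homeomorphic_sym homeomorphic_finite by blast
  then show False using infinite_Icc[of "0::real" 1] by simp
qed

text \<open>Injectivity of f is not assumed: each half is covered by the image of the other, and the
  two resulting cardinal inequalities combine by the Schroeder-Bernstein theorem.\<close>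

lemma equinumerous_halves:
  assumes "f ` M = M" "M \<subseteq> L \<union> R" "disjnt L R" "f ` (M \<inter> L) \<subseteq> R" "f ` (M \<inter> R) \<subseteq> L"
  shows "M \<inter> L \<approx> M \<inter> R"
proof (rule lepoll_antisym)
  have *: "\<exists>z\<in>M. y = f z" if "y \<in> M" for y
    using that assms(1) by (metis imageE[of y f M])
  have "y \<in> f ` (M \<inter> R)" if y: "y \<in> M \<inter> L" for y
  proof -
    obtain z where "z \<in> M" "y = f z" using * y by blast
    moreover from this have "z \<notin> L" using y assms(3,4) by (auto simp: disjnt_iff)
    ultimately show ?thesis using assms(2) by blast
  qed
  moreover have "y \<in> f ` (M \<inter> L)" if y: "y \<in> M \<inter> R" for y
  proof -
    obtain z where "z \<in> M" "y = f z" using * y by blast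
    moreover from this have "z \<notin> R" using y assms(3,5) by (auto simp: disjnt_iff)
    ultimately show ?thesis using assms(2) by blast
  qed
  ultimately have "M \<inter> L \<subseteq> f ` (M \<inter> R)" "M \<inter> R \<subseteq> f ` (M \<inter> L)"
    by auto
  then show "M \<inter> L \<lesssim> M \<inter> R" "M \<inter> R \<lesssim> M \<inter> L"
    by (auto intro: subset_image_lepoll)
qed

section \<open>Surjective interval maps and their lifts through the triangle wave\<close>

text \<open>The complement of A in [0,1] is nonempty and relatively open, so it contains two points
  u < v. There the values 0 and 1 can be prescribed freely before extending by Dugundji's theorem.
  The order of u and v is the one that \<open>tri_lift\<close> uses.\<close>

lemma surjective_modification:
  fixes \<phi> :: "real \<Rightarrow> real"
  assumes A: "closed A" "A \<subset> {0..1}" and \<phi>: "continuous_on A \<phi>" "\<phi> ` A \<subseteq> {0..1}"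
  obtains g u v where "continuous_on {0..1} g" "g ` {0..1} \<subseteq> {0..1}"
    "\<And>x. x \<in> A \<Longrightarrow> g x = \<phi> x" "0 \<le> u" "u < v" "v \<le> 1" "g u = 0" "g v = 1"
proof -
  obtain z where z: "z \<in> {0..1}" "z \<notin> A" using A(2) by blast
  have "open (- A)" using A(1) by auto
  then obtain e where e: "e > 0" "ball z e \<subseteq> - A"
    using z(2) by (meson ComplI open_contains_ball)
  \<comment> \<open>Half of e keeps w in the ball that avoids A; the cap 1/2, with the step taken
    away from the nearer end point, keeps w in [0,1].\<close>
  define d where "d = min (e / 2) (1 / 2)"
  define w where "w = (if z \<ge> 1 / 2 then z - d else z + d)"
  have d: "d > 0" "d \<le> 1 / 2" "d < e" using e(1) by (auto simp: d_def min_def)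
  have "w \<in> {0..1}" "w \<noteq> z" "w \<in> ball z e" using d z(1) by (auto simp: w_def dist_real_def)
  define u where "u = min z w"
  define v where "v = max z w"
  have uv: "0 \<le> u" "u < v" "v \<le> 1" "u \<notin> A" "v \<notin> A"
    using z \<open>w \<in> {0..1}\<close> \<open>w \<noteq> z\<close> \<open>w \<in> ball z e\<close> e(2) by (auto simp: u_def v_def min_def max_def)
  define \<phi>' where "\<phi>' x = (if x = u then 0 else if x = v then 1 else \<phi> x)" for x
  have "continuous_on A \<phi>'"
    using \<phi>(1) uv by (subst continuous_on_cong[OF refl, of A \<phi>' \<phi>]) (auto simp: \<phi>'_def)
  then have "continuous_on (A \<union> {u, v}) \<phi>'"
    using A(1) continuous_on_finite[of "{u, v}" \<phi>']
    by (intro continuous_on_closed_Un) (auto simp: finite_imp_closed)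
  moreover have "closedin (top_of_set {0..1}) (A \<union> {u, v})"
    using A uv by (intro closed_subset) auto
  moreover have "\<phi>' ` (A \<union> {u, v}) \<subseteq> {0..1}"
    using \<phi>(2) by (auto simp: \<phi>'_def)
  ultimately obtain g where g: "continuous_on {0..1} g" "g ` {0..1} \<subseteq> {0..1}"
    "\<And>x. x \<in> A \<union> {u, v} \<Longrightarrow> g x = \<phi>' x"
    using Dugundji[of "{0..1::real}" "{0..1}" "A \<union> {u, v}" \<phi>'] by auto
  show ?thesis
    by (rule that[of g u v]) (use g uv in \<open>auto simp: \<phi>'_def\<close>)
qed

text \<open>The graph of D over [0,2] is repeated along the diagonal, shifted by (2m, 2m); the
  condition on D 2 makes consecutive copies meet.\<close>

lemma continuous_on_translation_extension:
  fixes D :: "real \<Rightarrow> real"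
  assumes D: "continuous_on {0..2} D" and D2: "D 2 = D 0 + 2"
  defines "G \<equiv> \<lambda>t. D (t - 2 * of_int \<lfloor>t / 2\<rfloor>) + 2 * of_int \<lfloor>t / 2\<rfloor>"
  shows "continuous_on UNIV G"
proof -
  have G: "G t = D (t - 2 * of_int m) + 2 * of_int m" if "t \<in> {2 * of_int m..2 * of_int m + 2}" for t m
  proof (cases "t = 2 * of_int m + 2")
    \<comment> \<open>At the right end point the floor has already jumped to m + 1, so the agreement
      of the two copies is needed here.\<close>
    case True
    then have "\<lfloor>t / 2\<rfloor> = m + 1" by (simp add: floor_eq_iff)
    then show ?thesis using True D2 by (simp add: G_def)
  next
    case False
    then have "\<lfloor>t / 2\<rfloor> = m" using that by (auto simp: floor_eq_iff)
    then show ?thesis by (simp add: G_def)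
  qed
  have piece: "continuous_on {2 * of_int m..2 * of_int m + 2} G" for m
  proof -
    have "continuous_on {2 * of_int m..2 * of_int m + 2} (\<lambda>t. D (t - 2 * of_int m) + 2 * of_int m)"
      by (intro continuous_intros continuous_on_compose2[OF D]) auto
    then show ?thesis using G by (metis (no_types, lifting) continuous_on_cong)
  qed
  have "isCont G t" for t
  proof -
    \<comment> \<open>With the ceiling, t lies in (2m, 2m + 2]. Even a junction point is therefore
      interior to the union of the copies number m and m + 1.\<close>
    define m where "m = \<lceil>t / 2\<rceil> - 1"
    have "2 * of_int m < t"
      using ceiling_correct[of "t / 2"] by (simp add: m_def)
    moreover have "t < 2 * of_int \<lceil>t / 2\<rceil> + 2"
      using le_of_int_ceiling[of "t / 2"] by linarith
    then have "t < 2 * of_int (m + 1) + 2" by (simp add: m_def)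
    ultimately have m: "t \<in> {2 * of_int m<..<2 * of_int (m + 1) + 2}" by simp
    let ?S = "{2 * of_int m..2 * of_int m + 2} \<union> {2 * of_int (m+1)..2 * of_int (m+1) + 2} :: real set"
    have "continuous_on ?S G"
      by (intro continuous_on_closed_Un piece closed_atLeastAtMost)
    then have "continuous_on {2 * of_int m<..<2 * of_int (m+1) + 2} G"
      by (rule continuous_on_subset) auto
    then show ?thesis
      using m continuous_on_eq_continuous_at[OF open_greaterThanLessThan] by blast
  qed
  then show ?thesis by (simp add: continuous_on_eq_continuous_within continuous_at_imp_continuous_within)
qed

text \<open>The lift turns back wherever \<open>g\<close> does, except that it passes to the next branch of
  the triangle wave while the argument crosses from \<open>v\<close> back to \<open>u\<close>.\<close>

lemma tri_lift:
  fixes g :: "real \<Rightarrow> real"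
  assumes g: "continuous_on {0..1} g" "g ` {0..1} \<subseteq> {0..1}"
    and uv: "0 \<le> u" "u < v" "v \<le> 1" "g u = 0" "g v = 1"
  obtains G where "continuous_on UNIV G" "\<And>t. tri (G t) = g (tri t)" "\<And>t. \<bar>G t - t\<bar> \<le> 3"
proof -
  have g01: "0 \<le> g (tri t)" "g (tri t) \<le> 1" for t
    using g(2) tri_bounds[of t] by (auto simp: image_subset_iff)
  have tri_right: "tri t = 2 - t" if "1 \<le> t" "t \<le> 2" for t
    using tri_reflect[of t] tri_id[of "2 - t"] that by simp
  \<comment> \<open>At t = 2 - v the argument \<open>tri t\<close> is v and g is 1, where g and 2 -
    g agree; at t = 2 - u it is u and g is 0, where 2 - g and 2 + g agree. All three formulas lie
    over \<open>g (tri t)\<close>, by reflection and periodicity of the wave.\<close>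
  define D where "D t = (if t \<le> 2 - v then g (tri t) else if t \<le> 2 - u then 2 - g (tri t)
    else 2 + g (tri t))" for t
  have gt: "continuous_on S (\<lambda>t. g (tri t))" for S
    by (rule continuous_on_compose2[OF g(1)]) (auto intro!: continuous_intros simp: tri_bounds)
  have cD: "continuous_on {0..2} D"
    unfolding D_def
  proof (rule continuous_on_cases_le[where h = "\<lambda>t. t"])
    show "continuous_on {t \<in> {0..2}. t \<le> 2 - v} (\<lambda>t. g (tri t))" by (rule gt)
    show "continuous_on {t \<in> {0..2}. 2 - v \<le> t}
      (\<lambda>t. if t \<le> 2 - u then 2 - g (tri t) else 2 + g (tri t))"
    proof (rule continuous_on_cases_le[where h = "\<lambda>t. t"])
      show "2 - g (tri t) = 2 + g (tri t)" if "t \<in> {t \<in> {0..2}. 2 - v \<le> t}" "t = 2 - u" for t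
        using that uv tri_right[of t] by simp
    qed (intro continuous_on_diff continuous_on_add continuous_on_const continuous_on_id gt)+
    show "g (tri t) = (if t \<le> 2 - u then 2 - g (tri t) else 2 + g (tri t))"
      if "t \<in> {0..2}" "t = 2 - v" for t
      using that uv tri_right[of t] by simp
  qed (rule continuous_on_id)
  have tri2: "tri 2 = tri 0" using tri_reflect[of 0] by simp
  have D2: "D 2 = D 0 + 2"
  proof -
    have "tri 0 = 0" by (simp add: tri_id)
    \<comment> \<open>If u = 0, the middle branch applies at t = 2, and g 0 = 0 then gives the same
      value as the last branch.\<close>
    then show ?thesis using uv tri2 by (auto simp: D_def)
  qed
  have triD: "tri (D t) = g (tri t)" for t
    using g01[of t] tri_reflect[of "g (tri t)"] tri_periodic[of "g (tri t)" 1]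
    by (auto simp: D_def tri_id add.commute)
  have D_bound: "0 \<le> D t" "D t \<le> 3" for t using g01[of t] by (auto simp: D_def)
  define G where "G t = D (t - 2 * of_int \<lfloor>t / 2\<rfloor>) + 2 * of_int \<lfloor>t / 2\<rfloor>" for t
  show ?thesis
  proof (rule that[of G])
    show "continuous_on UNIV G"
      using continuous_on_translation_extension[OF cD D2] by (simp add: G_def)
    show "tri (G t) = g (tri t)" for t
      using triD[of "t - 2 * of_int \<lfloor>t / 2\<rfloor>"] tri_periodic[of t "- \<lfloor>t / 2\<rfloor>"]
      by (simp add: G_def tri_periodic)
    show "\<bar>G t - t\<bar> \<le> 3" for t
    proof -
      have "0 \<le> t - 2 * of_int \<lfloor>t / 2\<rfloor>" "t - 2 * of_int \<lfloor>t / 2\<rfloor> \<le> 2" by linarith+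
      then show ?thesis using D_bound[of "t - 2 * of_int \<lfloor>t / 2\<rfloor>"]
        unfolding G_def by linarith
    qed
  qed
qed

text \<open>The lifts of g and h are blended into one map K of the line, and a is -K transported to
  (-1,1). The minus sign exchanges the two ends and does not affect heights, because the wave is
  even. Being within 3 of the identity, K extends to the closed interval.\<close>

lemma wave_swap_parameter:
  fixes g h :: "real \<Rightarrow> real"
  assumes g: "continuous_on {0..1} g" "g ` {0..1} \<subseteq> {0..1}"
    and uv: "0 \<le> u" "u < v" "v \<le> 1" "g u = 0" "g v = 1"
    and h: "continuous_on {0..1} h" "h ` {0..1} \<subseteq> {0..1}"
    and uv': "0 \<le> u'" "u' < v'" "v' \<le> 1" "h u' = 0" "h v' = 1"
  obtains a where "continuous_on {-1..1} a" "a (-1) = 1" "a 1 = -1"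
    "\<And>s. \<bar>s\<bar> < 1 \<Longrightarrow> \<bar>a s\<bar> < 1"
    "\<And>s. -1 < s \<Longrightarrow> s \<le> 0 \<Longrightarrow> wave (a s) = g (wave s)"
    "\<And>s. 1 / 2 \<le> s \<Longrightarrow> s < 1 \<Longrightarrow> wave (a s) = h (wave s)"
proof -
  obtain G where G: "continuous_on UNIV G" "\<And>t. tri (G t) = g (tri t)" "\<And>t. \<bar>G t - t\<bar> \<le> 3"
    using tri_lift[OF g uv] by blast
  obtain H where H: "continuous_on UNIV H" "\<And>t. tri (H t) = h (tri t)" "\<And>t. \<bar>H t - t\<bar> \<le> 3"
    using tri_lift[OF h uv'] by blast
  \<comment> \<open>This weight selects G for t \<le> 0 and H for t \<ge> 1. Since
    \<open>squash 1\<close> is 1/2, these become the ranges s \<le> 0 and s \<ge> 1/2.\<close>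
  define c :: "real \<Rightarrow> real" where "c t = max 0 (min 1 t)" for t
  define K where "K t = (1 - c t) * G t + c t * H t" for t
  have c: "0 \<le> c t" "c t \<le> 1" for t by (auto simp: c_def)
  have K: "continuous_on UNIV K"
    unfolding K_def c_def by (intro continuous_intros G H)
  have K_near: "\<bar>K t - t\<bar> \<le> 3" for t
  proof -
    have "K t - t = (1 - c t) * (G t - t) + c t * (H t - t)"
      by (simp add: K_def algebra_simps)
    also have "\<bar>\<dots>\<bar> \<le> (1 - c t) * \<bar>G t - t\<bar> + c t * \<bar>H t - t\<bar>"
      using c[of t] abs_triangle_ineq[of "(1 - c t) * (G t - t)" "c t * (H t - t)"]
      by (simp add: abs_mult)
    also have "\<dots> \<le> (1 - c t) * 3 + c t * 3"
      using c[of t] G(3)[of t] H(3)[of t] by (intro add_mono mult_left_mono) auto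
    finally show ?thesis by simp
  qed
  \<comment> \<open>The deviation of the transported K from the identity. It tends to 0 at the ends,
    so that a, which equals b - s, is continuous up to -1 and 1.\<close>
  define b where "b s = (if \<bar>s\<bar> < 1 then s - squash (K (unsquash s)) else 0)" for s
  have "continuous_on {-1..1} b"
  proof (rule continuous_on_vanishing_ends)
    have "continuous_on {-1<..<1} (\<lambda>s. s - squash (K (unsquash s)))"
      by (intro continuous_intros continuous_on_compose2[OF K]) auto
    then show "continuous_on {-1<..<1} b"
      by (subst continuous_on_cong[OF refl]) (auto simp: b_def)
    show "\<bar>b s\<bar> \<le> 6 * (1 - \<bar>s\<bar>)" if "s \<in> {-1..1}" for s
    proof (cases "\<bar>s\<bar> < 1")
      case True
      have "\<bar>b s\<bar> = \<bar>squash (K (unsquash s)) - squash (unsquash s)\<bar>"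
        using True by (simp add: b_def squash_unsquash abs_minus_commute)
      also have "\<dots> \<le> 2 * \<bar>K (unsquash s) - unsquash s\<bar> * (1 / (1 + \<bar>unsquash s\<bar>))"
        using squash_diff_le[of "K (unsquash s)" "unsquash s"] by simp
      also have "\<dots> \<le> 6 * (1 - \<bar>s\<bar>)"
        using K_near[of "unsquash s"] True
        unfolding one_plus_abs_unsquash[OF True] by (intro mult_right_mono) auto
      finally show ?thesis .
    qed (use that in \<open>auto simp: b_def\<close>)
  qed
  then have ca: "continuous_on {-1..1} (\<lambda>s. b s - s)" by (intro continuous_intros)
  have a: "b s - s = squash (- K (unsquash s))" if "\<bar>s\<bar> < 1" for s
    using that by (simp add: b_def squash_minus)
  have wa: "wave (b s - s) = tri (K (unsquash s))" if "\<bar>s\<bar> < 1" for s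
    using a[OF that] by (simp add: wave_def)
  show ?thesis
  proof (rule that[OF ca])
    show "b (-1) - (-1) = 1" "b 1 - 1 = -1" by (simp_all add: b_def)
    show "\<bar>b s - s\<bar> < 1" if "\<bar>s\<bar> < 1" for s using a[OF that] abs_squash_less by simp
    show "wave (b s - s) = g (wave s)" if s: "-1 < s" "s \<le> 0" for s
    proof -
      have "unsquash s \<le> 0" using s by (simp add: unsquash_def divide_nonpos_pos)
      then have "K (unsquash s) = G (unsquash s)" by (simp add: K_def c_def)
      then show ?thesis using wa[of s] s G(2) by (simp add: wave_def)
    qed
    show "wave (b s - s) = h (wave s)" if s: "1 / 2 \<le> s" "s < 1" for s
    proof -
      have "unsquash s \<ge> 1" using s by (simp add: unsquash_def)
      then have "K (unsquash s) = H (unsquash s)" by (simp add: K_def c_def)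
      then show ?thesis using wa[of s] s H(2) by (simp add: wave_def)
    qed
  qed
qed

section \<open>The double sine curve\<close>

text \<open>The plane is embedded in sequence space as the first two coordinates, with all others
  0.\<close>

definition pt :: "real \<Rightarrow> real \<Rightarrow> nat \<Rightarrow> real" where
  "pt a b = (\<lambda>n. if n = 0 then a else if n = 1 then b else 0)"

definition end_arc :: "real \<Rightarrow> (nat \<Rightarrow> real) set" where
  "end_arc e = pt e ` {0..1}"

definition wave_line :: "(nat \<Rightarrow> real) set" where
  "wave_line = (\<lambda>s. pt s (wave s)) ` {-1<..<1}"

text \<open>Here e is 1 or -1 and names the end which the ray approaches. Both rays contain the
  point over 0, where they begin.\<close>

definition wave_ray :: "real \<Rightarrow> (nat \<Rightarrow> real) set" where
  "wave_ray e = (\<lambda>s. pt s (wave s)) ` {s. \<bar>s\<bar> < 1 \<and> 0 \<le> e * s}"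

definition wave_continuum :: "(nat \<Rightarrow> real) set" where
  "wave_continuum = end_arc (-1) \<union> wave_line \<union> end_arc 1"

lemma pt_coord [simp]: "pt a b 0 = a" "pt a b (Suc 0) = b"
  by (simp_all add: pt_def)

lemma pt_eq_iff [simp]: "pt a b = pt c d \<longleftrightarrow> a = c \<and> b = d"
  by (metis pt_coord)

lemma continuous_on_coord: "continuous_on S (\<lambda>x::nat \<Rightarrow> real. x i)"
  by (rule continuous_on_subset[OF continuous_on_product_coordinates subset_UNIV])

lemma continuous_on_pt:
  assumes "continuous_on S f" "continuous_on S g"
  shows "continuous_on S (\<lambda>x. pt (f x) (g x))"
proof (rule continuous_on_coordinatewise_then_product)
  show "continuous_on S (\<lambda>x. pt (f x) (g x) i)" for i
    using assms unfolding pt_def by (cases "i = 0"; cases "i = 1") auto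
qed

lemma mem_end_arc: "x \<in> end_arc e \<longleftrightarrow> (\<exists>y. x = pt e y \<and> 0 \<le> y \<and> y \<le> 1)"
  by (auto simp: end_arc_def)

lemma mem_wave_line: "x \<in> wave_line \<longleftrightarrow> (\<exists>s. x = pt s (wave s) \<and> \<bar>s\<bar> < 1)"
  by (auto simp: wave_line_def image_iff abs_less_iff)

lemma mem_wave_continuum:
  "x \<in> wave_continuum \<longleftrightarrow>
    (\<exists>s y. x = pt s y \<and> \<bar>s\<bar> \<le> 1 \<and> 0 \<le> y \<and> y \<le> 1 \<and> (\<bar>s\<bar> < 1 \<longrightarrow> y = wave s))"
  (is "_ \<longleftrightarrow> ?rhs")
proof
  show ?rhs if "x \<in> wave_continuum"
    using that wave_bounds unfolding wave_continuum_def Un_iff mem_end_arc mem_wave_line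
    by force
next
  assume ?rhs
  then obtain s y where "x = pt s y" "\<bar>s\<bar> \<le> 1" "0 \<le> y" "y \<le> 1" "\<bar>s\<bar> < 1 \<longrightarrow> y = wave s"
    by blast
  moreover from this(2) consider "\<bar>s\<bar> < 1" | "s = -1" | "s = 1" by linarith
  ultimately show "x \<in> wave_continuum"
    unfolding wave_continuum_def Un_iff mem_end_arc mem_wave_line by cases auto
qed

lemma wave_continuum_coordE:
  assumes "x \<in> wave_continuum"
  shows "-1 \<le> x 0" "x 0 \<le> 1" "0 \<le> x (Suc 0)" "x (Suc 0) \<le> 1" "x = pt (x 0) (x (Suc 0))"
    "\<bar>x 0\<bar> < 1 \<Longrightarrow> x (Suc 0) = wave (x 0)"
  using assms by (auto simp: mem_wave_continuum abs_le_iff)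

lemma homeomorphic_by_inverses:
  assumes "continuous_on S f" "continuous_on T g" "\<And>x. x \<in> S \<Longrightarrow> f x \<in> T" "\<And>y. y \<in> T \<Longrightarrow> g y \<in> S"
    "\<And>x. x \<in> S \<Longrightarrow> g (f x) = x" "\<And>y. y \<in> T \<Longrightarrow> f (g y) = y"
  shows "S homeomorphic T"
proof (rule homeomorphicI[OF _ _ assms(1,2,5,6)])
  show "f ` S = T" by (intro equalityI image_subsetI subsetI) (metis assms(3), metis assms(4,6) imageI)
  show "g ` T = S" by (intro equalityI image_subsetI subsetI) (metis assms(4), metis assms(3,5) imageI)
qed

lemma end_arc_homeomorphic: "end_arc e homeomorphic {0..1::real}"
proof (rule homeomorphic_by_inverses[where f = "\<lambda>x. x (Suc 0)" and g = "pt e"])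
  show "continuous_on {0..1} (pt e)"
    using continuous_on_pt[OF continuous_on_const continuous_on_id] by simp
qed (auto simp: mem_end_arc intro: continuous_on_coord)

lemma wave_line_homeomorphic: "wave_line homeomorphic {-1<..<1::real}"
proof (rule homeomorphic_by_inverses[where f = "\<lambda>x. x 0" and g = "\<lambda>s. pt s (wave s)"])
  show "continuous_on {-1<..<1} (\<lambda>s. pt s (wave s))"
    by (intro continuous_on_pt continuous_intros) auto
  show "continuous_on wave_line (\<lambda>x. x 0)" by (rule continuous_on_coord)
qed (auto simp: wave_line_def)

lemma wave_line_homeomorphic_unit: "wave_line homeomorphic {0<..<1::real}"
proof -
  have "{-1<..<1::real} homeomorphic {0<..<1::real}"
  proof (rule homeomorphic_by_inverses[where f = "\<lambda>s. (s + 1) / 2" and g = "\<lambda>t. 2 * t - 1"])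
    show "continuous_on {-1<..<1::real} (\<lambda>s. (s + 1) / 2)"
      by (intro continuous_intros) simp
    show "continuous_on {0<..<1::real} (\<lambda>t. 2 * t - 1)"
      by (intro continuous_intros)
  qed (simp_all add: field_simps)
  with wave_line_homeomorphic show ?thesis by (rule homeomorphic_trans)
qed

lemma wave_ray_homeomorphic:
  assumes e: "\<bar>e\<bar> = 1"
  shows "wave_ray e homeomorphic {0::real..}"
proof -
  have ee: "e * e = 1" "e \<noteq> 0" using e by (auto simp: abs_if split: if_splits)
  have sq: "0 \<le> e * squash (e * t)" if "0 \<le> t" for t
  proof -
    have "e * squash (e * t) = t / (1 + \<bar>t\<bar>)"
      using ee e by (simp add: squash_def abs_mult mult.assoc[symmetric])
    then show ?thesis using that by simp
  qed
  have unsq: "0 \<le> e * unsquash s" if "0 \<le> e * s" "\<bar>s\<bar> < 1" for s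
    using that by (simp add: unsquash_def)
  have inv1: "squash (e * (e * unsquash s)) = s" if "\<bar>s\<bar> < 1" for s
    using that ee by (simp add: mult.assoc[symmetric] squash_unsquash)
  have inv2: "e * unsquash (squash (e * t)) = t" for t
    using ee by (simp add: mult.assoc[symmetric])
  let ?f = "\<lambda>x::nat \<Rightarrow> real. e * unsquash (x 0)"
  let ?g = "\<lambda>t. pt (squash (e * t)) (wave (squash (e * t)))"
  have f: "?f x \<in> {0..}" "?g (?f x) = x" if "x \<in> wave_ray e" for x
    using that unsq inv1 by (auto simp: wave_ray_def)
  have g: "?g t \<in> wave_ray e" "?f (?g t) = t" if "t \<in> {0..}" for t
    using that sq abs_squash_less inv2 by (auto simp: wave_ray_def)
  show ?thesis
  proof (rule homeomorphic_by_inverses[where f = ?f and g = ?g])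
    show "continuous_on (wave_ray e) ?f"
      by (intro continuous_intros continuous_on_coord) (auto simp: wave_ray_def)
    show "continuous_on {0..} ?g"
      by (intro continuous_on_pt continuous_intros) (auto simp: abs_squash_less)
  qed (fact f g)+
qed

lemma wave_attains_near_end:
  assumes "\<bar>e\<bar> = 1" "0 \<le> y" "y \<le> 1" "0 < \<epsilon>"
  obtains s where "\<bar>s\<bar> < 1" "0 \<le> e * s" "wave s = y" "\<bar>s - e\<bar> < \<epsilon>"
proof -
  obtain s where s: "-1 < s" "s < -1 + \<epsilon>" "s < 0" "wave s = y"
    using wave_attains_near_minus_one[of "-1 + \<epsilon>" y] assms by auto
  from assms(1) consider "e = 1" | "e = -1" by linarith
  then show ?thesis
    by cases (use s that[of s] that[of "-s"] in auto)
qed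

text \<open>At a fixed height y the ray has points whose first coordinates accumulate at e, and s
  \<mapsto> \<open>pt s y\<close> is continuous.\<close>

lemma end_arc_subset_closure:
  assumes e: "\<bar>e\<bar> = 1"
  shows "end_arc e \<subseteq> closure (wave_ray e)"
proof
  fix x assume "x \<in> end_arc e"
  then obtain y where y: "x = pt e y" "0 \<le> y" "y \<le> 1" by (auto simp: mem_end_arc)
  let ?T = "{s. \<bar>s\<bar> < 1 \<and> 0 \<le> e * s \<and> wave s = y}"
  have "e \<in> closure ?T"
    unfolding closure_approachable
  proof (intro allI impI)
    fix \<epsilon> :: real assume "0 < \<epsilon>"
    then obtain s where "\<bar>s\<bar> < 1" "0 \<le> e * s" "wave s = y" "\<bar>s - e\<bar> < \<epsilon>"
      using wave_attains_near_end[OF e y(2,3)] by metis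
    then show "\<exists>s\<in>?T. dist s e < \<epsilon>"
      by (intro bexI[of _ s]) (simp_all add: dist_real_def)
  qed
  moreover have "(\<lambda>s. pt s y) ` closure ?T \<subseteq> closure (wave_ray e)"
  proof (rule image_closure_subset)
    show "continuous_on (closure ?T) (\<lambda>s. pt s y)"
      by (intro continuous_on_pt continuous_intros)
    have "(\<lambda>s. pt s y) ` ?T \<subseteq> wave_ray e" by (auto simp: wave_ray_def)
    then show "(\<lambda>s. pt s y) ` ?T \<subseteq> closure (wave_ray e)" using closure_subset by blast
  qed simp
  ultimately show "x \<in> closure (wave_ray e)" using y(1) by blast
qed

lemma wave_ray_subset: "wave_ray e \<subseteq> wave_line"
  by (auto simp: wave_ray_def mem_wave_line)

lemma wave_line_eq_rays: "wave_line = wave_ray (-1) \<union> wave_ray 1"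
proof
  show "wave_line \<subseteq> wave_ray (-1) \<union> wave_ray 1"
  proof
    fix x assume "x \<in> wave_line"
    then obtain s where "x = pt s (wave s)" "\<bar>s\<bar> < 1" by (auto simp: mem_wave_line)
    then show "x \<in> wave_ray (-1) \<union> wave_ray 1"
      by (cases "0 \<le> s") (auto simp: wave_ray_def)
  qed
qed (use wave_ray_subset in auto)

lemma wave_continuum_subset_closure: "wave_continuum \<subseteq> closure wave_line"
  using end_arc_subset_closure[of 1] end_arc_subset_closure[of "-1"] closure_subset[of wave_line]
    closure_mono[OF wave_ray_subset, of 1] closure_mono[OF wave_ray_subset, of "-1"]
  unfolding wave_continuum_def by auto

text \<open>The set is the image of the zero set of (1 - |s|) y - (1 - |s|) \<open>wave s\<close> in
  a closed rectangle. The common factor keeps the function continuous and admits every height on the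
  two vertical edges.\<close>

lemma compact_wave_continuum: "compact wave_continuum"
proof -
  let ?Q = "{-1..1} \<times> {0..1} :: (real \<times> real) set"
  let ?d = "\<lambda>p::real \<times> real. (1 - \<bar>fst p\<bar>) * snd p - (1 - \<bar>fst p\<bar>) * wave (fst p)"
  let ?P = "{p \<in> ?Q. ?d p = 0}"
  have "continuous_on ?Q (\<lambda>p. (1 - \<bar>fst p\<bar>) * wave (fst p))"
    by (rule continuous_on_compose2[OF continuous_on_damped_wave, of _ fst])
       (auto intro!: continuous_intros)
  moreover have "continuous_on ?Q (\<lambda>p. (1 - \<bar>fst p\<bar>) * snd p)"
    by (intro continuous_intros)
  ultimately have "continuous_on ?Q ?d"
    by (intro continuous_on_diff)
  then have "closed ?P"
    by (intro continuous_closed_preimage_constant) (auto intro: closed_Times)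
  moreover have "bounded ?P"
    by (rule bounded_subset[of ?Q]) (auto intro: bounded_Times)
  ultimately have "compact ?P" by (simp add: compact_eq_bounded_closed)
  moreover have "continuous_on ?P (\<lambda>p. pt (fst p) (snd p))"
    by (intro continuous_on_pt continuous_intros)
  ultimately have "compact ((\<lambda>p. pt (fst p) (snd p)) ` ?P)"
    by (rule compact_continuous_image[rotated])
  moreover have "(\<lambda>p. pt (fst p) (snd p)) ` ?P = wave_continuum"
  proof -
    have "p \<in> ?P \<longleftrightarrow> \<bar>fst p\<bar> \<le> 1 \<and> 0 \<le> snd p \<and> snd p \<le> 1 \<and> (\<bar>fst p\<bar> < 1 \<longrightarrow> snd p = wave (fst p))"
      for p by (cases p) (auto simp: abs_le_iff abs_less_iff)
    then show ?thesis
      by (auto simp: image_iff mem_wave_continuum)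
  qed
  ultimately show ?thesis by simp
qed

lemma connected_wave_line: "connected wave_line"
  using homeomorphic_connectedness[OF wave_line_homeomorphic] connected_Ioo by blast

lemma connected_wave_continuum: "connected wave_continuum"
  by (rule connected_intermediate_closure[OF connected_wave_line])
     (use wave_continuum_subset_closure in \<open>auto simp: wave_continuum_def\<close>)

section \<open>Membership of the double sine curve in the class C\<close>

lemma dense_inI: "A \<subseteq> X \<Longrightarrow> X \<subseteq> closure A \<Longrightarrow> dense_in X A"
  by (auto simp: dense_in_def closure_of_subtopology Int_absorb1)

text \<open>A nonempty relatively open subset of A would have to meet the dense set J.\<close>

lemma nowhere_dense_in_complement:
  assumes "X \<subseteq> closure J" "closed A" "A \<subseteq> X" "A \<inter> J = {}" "J \<subseteq> X"
  shows "nowhere_dense_in X A"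
proof -
  have cl: "top_of_set X closure_of A = A"
    using assms by (intro closure_of_closedin closed_subset)
  have "top_of_set X interior_of A = {}"
  proof (rule ccontr)
    assume "\<not> ?thesis"
    then obtain x where x: "x \<in> top_of_set X interior_of A" by blast
    obtain T where T: "open T" "top_of_set X interior_of A = X \<inter> T"
      using openin_interior_of[of "top_of_set X" A] unfolding openin_open by blast
    have "T \<inter> closure J \<noteq> {}" using x T(2) assms(1) by blast
    then have "T \<inter> J \<noteq> {}" using open_Int_closure_eq_empty[OF T(1)] by blast
    then show False using T(2) interior_of_subset[of "top_of_set X" A] assms(4,5) by blast
  qed
  with cl assms(3) show ?thesis by (simp add: nowhere_dense_in_def)
qed

lemma compact_end_arc: "compact (end_arc e)"
  using homeomorphic_compactness[OF end_arc_homeomorphic] by auto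

lemma connected_end_arc: "connected (end_arc e)"
  using homeomorphic_connectedness[OF end_arc_homeomorphic] by auto

lemma continuum_end_arc: "continuum (end_arc e)"
  unfolding continuum_def using compact_end_arc connected_end_arc by (auto simp: end_arc_def)

lemma locally_connected_end_arc: "locally connected (end_arc e)"
proof -
  have "locally connected (end_arc e) \<longleftrightarrow> locally connected {0..1::real}"
    by (rule homeomorphic_locally[OF end_arc_homeomorphic])
       (rule homeomorphic_connectedness)
  then show ?thesis by (simp add: convex_imp_locally_connected)
qed

lemma disjnt_end_arc_wave_line: "\<bar>e\<bar> = 1 \<Longrightarrow> disjnt (end_arc e) wave_line"
  by (auto simp: disjnt_iff mem_end_arc mem_wave_line)

lemma disjnt_end_arcs: "e \<noteq> e' \<Longrightarrow> disjnt (end_arc e) (end_arc e')"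
  by (auto simp: disjnt_iff mem_end_arc)

text \<open>The closed half space given by \<open>0 \<le> e * x 0\<close> cuts exactly the arc and
  its ray out of the compact curve.\<close>

lemma half_compactification:
  assumes e: "\<bar>e\<bar> = 1"
  shows "compactification_with_remainder (end_arc e \<union> wave_ray e) (wave_ray e) (end_arc e)"
proof -
  have "end_arc e \<union> wave_ray e = wave_continuum \<inter> {x. 0 \<le> e * x 0}"
  proof (intro set_eqI iffI)
    fix x assume "x \<in> end_arc e \<union> wave_ray e"
    then show "x \<in> wave_continuum \<inter> {x. 0 \<le> e * x 0}"
      using e wave_bounds by (auto simp: mem_wave_continuum mem_end_arc wave_ray_def)
  next
    fix x assume "x \<in> wave_continuum \<inter> {x. 0 \<le> e * x 0}"
    then obtain s y where x: "x = pt s y" "\<bar>s\<bar> \<le> 1" "0 \<le> y" "y \<le> 1" "\<bar>s\<bar> < 1 \<longrightarrow> y = wave s"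
      "0 \<le> e * s" by (auto simp: mem_wave_continuum)
    show "x \<in> end_arc e \<union> wave_ray e"
    proof (cases "\<bar>s\<bar> < 1")
      case True
      with x show ?thesis by (auto simp: wave_ray_def)
    next
      case False
      then have "s = e" using x e by (auto simp: abs_if split: if_splits)
      with x show ?thesis by (auto simp: mem_end_arc)
    qed
  qed
  moreover have "closed {x::nat \<Rightarrow> real. 0 \<le> e * x 0}"
    by (intro closed_Collect_le continuous_intros continuous_on_coord)
  ultimately have "compact (end_arc e \<union> wave_ray e)"
    using compact_wave_continuum compact_Int_closed by metis
  moreover have "dense_in (end_arc e \<union> wave_ray e) (wave_ray e)"
    using end_arc_subset_closure[OF e] closure_subset by (intro dense_inI) auto
  moreover have "end_arc e \<union> wave_ray e - wave_ray e = end_arc e"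
    using disjnt_end_arc_wave_line[OF e] wave_ray_subset[of e] by (auto simp: disjnt_iff)
  ultimately show ?thesis by (simp add: compactification_with_remainder_def)
qed

lemma openin_wave_line: "openin (top_of_set wave_continuum) wave_line"
proof -
  have "wave_line = wave_continuum \<inter> {x. \<bar>x 0\<bar> < 1}"
    by (auto simp: wave_continuum_def mem_end_arc mem_wave_line)
  moreover have "open {x::nat \<Rightarrow> real. \<bar>x 0\<bar> < 1}"
    by (intro open_Collect_less continuous_intros continuous_on_coord)
  ultimately show ?thesis by (auto simp: openin_open)
qed

lemma class_C_wave_continuum: "class_C wave_continuum (end_arc (-1)) wave_line (end_arc 1)"
proof -
  have sub: "end_arc (-1) \<subseteq> wave_continuum" "end_arc 1 \<subseteq> wave_continuum" "wave_line \<subseteq> wave_continuum"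
    by (auto simp: wave_continuum_def)
  have nd: "nowhere_dense_in wave_continuum (end_arc e)" if "\<bar>e\<bar> = 1" "end_arc e \<subseteq> wave_continuum" for e
    using that disjnt_end_arc_wave_line[of e] wave_continuum_subset_closure sub(3)
    by (intro nowhere_dense_in_complement[of _ wave_line] compact_imp_closed compact_end_arc)
       (auto simp: disjnt_def)
  have "continuum wave_continuum"
    using compact_wave_continuum connected_wave_continuum sub(1)
    unfolding continuum_def by (auto simp: end_arc_def)
  moreover have "dense_in wave_continuum wave_line"
    by (rule dense_inI[OF sub(3) wave_continuum_subset_closure])
  moreover have "is_ray (wave_ray (-1))" "is_ray (wave_ray 1)"
    unfolding is_ray_def by (simp_all add: wave_ray_homeomorphic)
  moreover have "free_interval wave_continuum wave_line"
    by (simp add: free_interval_def openin_wave_line wave_line_homeomorphic_unit)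
  ultimately show ?thesis
    unfolding class_C_def
    using wave_line_eq_rays half_compactification[of "-1"] half_compactification[of 1]
      nd[OF _ sub(1)] nd[OF _ sub(2)]
    by (auto simp: continuum_end_arc locally_connected_end_arc disjnt_end_arc_wave_line
        wave_continuum_def)
qed

section \<open>Path components of the double sine curve\<close>

lemma path_connected_meeting_end_arc:
  assumes e: "\<bar>e\<bar> = 1" and P: "path_connected P" "P \<subseteq> wave_continuum" "P \<inter> end_arc e \<noteq> {}"
  shows "P \<subseteq> end_arc e"
proof
  fix y assume y: "y \<in> P"
  obtain x where x: "x \<in> P" "x \<in> end_arc e" using P(3) by blast
  obtain p where p: "path p" "path_image p \<subseteq> P" "pathstart p = x" "pathfinish p = y"
    using P(1) x(1) y unfolding path_connected_def by blast
  have pX: "p t \<in> wave_continuum" if "t \<in> {0..1}" for t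
    using p(2) P(2) that unfolding path_image_def by blast
  have cp: "continuous_on {0..1} (\<lambda>t. p t i)" for i
    using p(1) unfolding path_def by (rule continuous_on_product_then_coordinatewise)
  have e_cases: "e = 1 \<or> e = -1" using e by linarith
  \<comment> \<open>Multiplication by -e moves the arc over e to the abscissa -1. As the wave is
    even, the remaining points still lie on its graph, and \<open>no_escape_from_limit\<close>
    applies.\<close>
  have "- e * p 1 0 = -1"
  proof (rule no_escape_from_limit[where p\<^sub>0 = "\<lambda>t. - e * p t 0" and p\<^sub>1 = "\<lambda>t. p t (Suc 0)" and t = 1])
    show "continuous_on {0..1} (\<lambda>t. - e * p t 0)" by (intro continuous_intros cp)
    show "continuous_on {0..1} (\<lambda>t. p t (Suc 0))" by (rule cp)
    show "-1 \<le> - e * p t 0" if "t \<in> {0..1}" for t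
      using wave_continuum_coordE(1,2)[OF pX[OF that]] e_cases by auto
    show "p t (Suc 0) = wave (- e * p t 0)" if "t \<in> {0..1}" "\<bar>- e * p t 0\<bar> < 1" for t
      using wave_continuum_coordE(6)[OF pX[OF that(1)]] that(2) e_cases by auto
    show "- e * p 0 0 = -1"
      using p(3) x(2) e_cases by (auto simp: pathstart_def mem_end_arc)
  qed auto
  then have "y 0 = e" using p(4) e_cases by (auto simp: pathfinish_def)
  moreover have "y \<in> wave_continuum" using P(2) y by blast
  ultimately show "y \<in> end_arc e"
    using wave_continuum_coordE(3-5)[of y] by (auto simp: mem_end_arc)
qed

lemma path_connected_subset_cases:
  assumes "path_connected P" "P \<subseteq> wave_continuum"
  obtains "P \<subseteq> end_arc (-1)" | "P \<subseteq> wave_line" | "P \<subseteq> end_arc 1"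
  using path_connected_meeting_end_arc[of "-1" P] path_connected_meeting_end_arc[of 1 P] assms
  unfolding wave_continuum_def by fastforce

lemma path_connected_end_arc: "path_connected (end_arc e)"
proof -
  have "continuous_on {0..1} (pt e)"
    using continuous_on_pt[OF continuous_on_const continuous_on_id] by simp
  then show ?thesis unfolding end_arc_def
    by (intro path_connected_continuous_image) auto
qed

lemma path_connected_wave_line: "path_connected wave_line"
  unfolding wave_line_def
  by (intro path_connected_continuous_image continuous_on_pt continuous_intros) (auto intro: convex_imp_path_connected)

section \<open>Minimal sets of the double sine curve\<close>

text \<open>If J is sent into L or R, density sends everything there. Otherwise J is sent into J, so
  a point of M in an arc has its preimages in M on the arcs. An arc sent into itself either contains
  M or misses it; every other pattern except the interchange leaves an arc without such
  preimages.\<close>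

lemma minimal_set_location:
  fixes f :: "'a::metric_space \<Rightarrow> 'a"
  assumes f: "continuous_on X f" and X: "X = L \<union> J \<union> R"
    and disj: "L \<inter> J = {}" "R \<inter> J = {}" "L \<inter> R = {}"
    and closed: "closed L" "closed R" and dense: "X = closure J"
    and L: "f ` L \<subseteq> L \<or> f ` L \<subseteq> J \<or> f ` L \<subseteq> R"
    and J: "f ` J \<subseteq> L \<or> f ` J \<subseteq> J \<or> f ` J \<subseteq> R"
    and R: "f ` R \<subseteq> L \<or> f ` R \<subseteq> J \<or> f ` R \<subseteq> R"
    and M: "M \<subseteq> X" "f ` M = M" "minimal_system M f"
  obtains "M \<subseteq> J" | "M \<subseteq> L" | "M \<subseteq> R"
    | "f ` L \<subseteq> R" "f ` R \<subseteq> L" "M \<subseteq> L \<union> R" "M \<inter> L \<noteq> {}" "M \<inter> R \<noteq> {}"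
proof -
  note location = that
  have im: "f x \<in> M" if "x \<in> M" for x using M(2) that by auto
  have sur: "\<exists>x\<in>M. y = f x" if "y \<in> M" for y
    using that M(2) by (metis imageE)
  have inv: "M \<subseteq> C" if "closed C" "M \<inter> C \<noteq> {}" "f ` (M \<inter> C) \<subseteq> C" for C
    using minimal_system_subset_closed[OF M(3)] that by blast
  have ne: "M \<noteq> {}" using M(3) by (simp add: minimal_system_def)
  \<comment> \<open>Continuity extends the inclusion from J to its closure X, and M is its own
    image.\<close>
  have whole: "M \<subseteq> C" if "f ` J \<subseteq> C" "closed C" for C
  proof -
    have "f ` closure J \<subseteq> C"
      using f dense that by (intro image_closure_subset) auto
    then show ?thesis using dense M(1) sur by blast
  qed
  have LL: "M \<subseteq> L" if "f ` L \<subseteq> L" "M \<inter> L \<noteq> {}"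
    using inv[OF closed(1) that(2)] that(1) by blast
  have RR: "M \<subseteq> R" if "f ` R \<subseteq> R" "M \<inter> R \<noteq> {}"
    using inv[OF closed(2) that(2)] that(1) by blast
  have LR: "M \<subseteq> L \<union> R" if "f ` L \<subseteq> R" "f ` R \<subseteq> L" "M \<inter> (L \<union> R) \<noteq> {}"
    using inv[OF closed_Un[OF closed] that(3)] that(1,2) by blast
  have JM: "M \<subseteq> J" if "M \<inter> L = {}" "M \<inter> R = {}" using that M(1) X by blast
  have mem: "x \<in> L \<or> x \<in> J \<or> x \<in> R" if "x \<in> M" for x using that M(1) X by blast
  have disj': "x \<notin> L \<or> x \<notin> J" "x \<notin> R \<or> x \<notin> J" "x \<notin> L \<or> x \<notin> R" for x
    using disj by blast+
  consider "M \<subseteq> L" | "M \<subseteq> R" | "f ` J \<subseteq> J"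
    using J whole closed by blast
  then show thesis
  proof cases
    case 3
    have noL: "M \<inter> L = {}" if "M \<inter> R = {}" "f ` L \<subseteq> J \<or> f ` L \<subseteq> R"
    proof (rule ccontr)
      assume "M \<inter> L \<noteq> {}"
      then obtain y where y: "y \<in> M" "y \<in> L" by blast
      then obtain x where x: "x \<in> M" "y = f x" using sur by blast
      show False using mem[OF x(1)] x y that 3 disj'[of y] by blast
    qed
    have noR: "M \<inter> R = {}" if "M \<inter> L = {}" "f ` R \<subseteq> J \<or> f ` R \<subseteq> L"
    proof (rule ccontr)
      assume "M \<inter> R \<noteq> {}"
      then obtain y where y: "y \<in> M" "y \<in> R" by blast
      then obtain x where x: "x \<in> M" "y = f x" using sur by blast
      show False using mem[OF x(1)] x y that 3 disj'[of y] by blast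
    qed
    have noL': "M \<inter> L = {}" if "f ` L \<subseteq> J \<or> f ` L \<subseteq> R" "f ` R \<subseteq> J \<or> f ` R \<subseteq> R"
    proof (rule ccontr)
      assume "M \<inter> L \<noteq> {}"
      then obtain y where y: "y \<in> M" "y \<in> L" by blast
      then obtain x where x: "x \<in> M" "y = f x" using sur by blast
      show False using mem[OF x(1)] x y that 3 disj'[of y] by blast
    qed
    have noR': "M \<inter> R = {}" if "f ` L \<subseteq> J \<or> f ` L \<subseteq> L" "f ` R \<subseteq> J \<or> f ` R \<subseteq> L"
    proof (rule ccontr)
      assume "M \<inter> R \<noteq> {}"
      then obtain y where y: "y \<in> M" "y \<in> R" by blast
      then obtain x where x: "x \<in> M" "y = f x" using sur by blast
      show False using mem[OF x(1)] x y that 3 disj'[of y] by blast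
    qed
    have swap: thesis if sw: "f ` L \<subseteq> R" "f ` R \<subseteq> L" "M \<inter> (L \<union> R) \<noteq> {}"
    proof (rule location(4)[OF sw(1,2) LR[OF sw]])
      obtain x where x: "x \<in> M" "x \<in> L \<or> x \<in> R" using sw(3) by blast
      then have "f x \<in> M" "x \<in> L \<longrightarrow> f x \<in> R" "x \<in> R \<longrightarrow> f x \<in> L"
        using im sw(1,2) by blast+
      with x show "M \<inter> L \<noteq> {}" "M \<inter> R \<noteq> {}" by blast+
    qed
    show thesis
    proof (rule ccontr)
      assume no: "\<not> thesis"
      have a: "\<not> M \<subseteq> L" "\<not> M \<subseteq> R" "M \<inter> L \<noteq> {} \<or> M \<inter> R \<noteq> {}"
        using no location(1-3) JM by blast+
      have b: "f ` L \<subseteq> L \<Longrightarrow> M \<inter> L = {}" "f ` R \<subseteq> R \<Longrightarrow> M \<inter> R = {}"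
        using LL RR a by blast+
      have c: "\<not> (f ` L \<subseteq> R \<and> f ` R \<subseteq> L)" using swap no a(3) by blast
      \<comment> \<open>These are the nine patterns for the images of L and R; all but the
        interchange, excluded by c, make M miss both arcs.\<close>
      show False using L R a(3) b c noL noR noL' noR' by metis
    qed
  qed (use location in blast)+
qed

section \<open>Extending an interchange of the two arcs over the whole curve\<close>

text \<open>The first coordinate is moved by the parameter a. Near the arcs the new height is
  computed from the old height by g or h, and not from the abscissa, because the wave has no limit
  there.\<close>

lemma wave_swap_extension:
  fixes g h :: "real \<Rightarrow> real"
  assumes g: "continuous_on {0..1} g" "g ` {0..1} \<subseteq> {0..1}"
    and uv: "0 \<le> u" "u < v" "v \<le> 1" "g u = 0" "g v = 1"
    and h: "continuous_on {0..1} h" "h ` {0..1} \<subseteq> {0..1}"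
    and uv': "0 \<le> u'" "u' < v'" "v' \<le> 1" "h u' = 0" "h v' = 1"
  obtains F where "continuous_on wave_continuum F" "F ` wave_continuum \<subseteq> wave_continuum"
    "\<And>y. F (pt (-1) y) = pt 1 (g y)" "\<And>y. F (pt 1 y) = pt (-1) (h y)"
proof -
  obtain a where a: "continuous_on {-1..1} a" "a (-1) = 1" "a 1 = -1"
    "\<And>s. \<bar>s\<bar> < 1 \<Longrightarrow> \<bar>a s\<bar> < 1"
    "\<And>s. -1 < s \<Longrightarrow> s \<le> 0 \<Longrightarrow> wave (a s) = g (wave s)"
    "\<And>s. 1 / 2 \<le> s \<Longrightarrow> s < 1 \<Longrightarrow> wave (a s) = h (wave s)"
    using wave_swap_parameter[OF g uv h uv'] by metis
  \<comment> \<open>Over |s| < 1 all three formulas equal \<open>wave (a s)\<close>; hence they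
    agree at the thresholds 0 and 1/2, and the image stays on the curve.\<close>
  let ?Y = "\<lambda>x::nat \<Rightarrow> real. if x 0 \<le> 0 then g (x (Suc 0))
    else if x 0 \<le> 1 / 2 then wave (a (x 0)) else h (x (Suc 0))"
  let ?F = "\<lambda>x::nat \<Rightarrow> real. pt (a (x 0)) (?Y x)"
  note co = wave_continuum_coordE
  have contY: "continuous_on wave_continuum ?Y"
  proof (rule continuous_on_cases_le[where h = "\<lambda>x::nat \<Rightarrow> real. x 0"])
    show "continuous_on {x \<in> wave_continuum. x 0 \<le> 0} (\<lambda>x. g (x (Suc 0)))"
      by (rule continuous_on_compose2[OF g(1)]) (auto intro: continuous_on_coord co)
    show "continuous_on {x \<in> wave_continuum. 0 \<le> x 0}
        (\<lambda>x. if x 0 \<le> 1 / 2 then wave (a (x 0)) else h (x (Suc 0)))"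
    proof (rule continuous_on_cases_le[where h = "\<lambda>x::nat \<Rightarrow> real. x 0"])
      let ?S = "{x \<in> {x \<in> wave_continuum. 0 \<le> x 0}. x 0 \<le> 1 / 2}"
      have "continuous_on ?S (\<lambda>x. a (x 0))"
        by (rule continuous_on_compose2[OF a(1)]) (auto intro: continuous_on_coord)
      then show "continuous_on ?S (\<lambda>x. wave (a (x 0)))"
        by (rule continuous_on_wave) (auto intro: a(4))
      show "continuous_on {x \<in> {x \<in> wave_continuum. 0 \<le> x 0}. 1 / 2 \<le> x 0} (\<lambda>x. h (x (Suc 0)))"
        by (rule continuous_on_compose2[OF h(1)]) (auto intro: continuous_on_coord co)
      show "wave (a (x 0)) = h (x (Suc 0))"
        if "x \<in> {x \<in> wave_continuum. 0 \<le> x 0}" "x 0 = 1 / 2" for x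
        using that co(6)[of x] a(6)[of "x 0"] by simp
    qed (rule continuous_on_coord)
    show "g (x (Suc 0)) = (if x 0 \<le> 1 / 2 then wave (a (x 0)) else h (x (Suc 0)))"
      if "x \<in> wave_continuum" "x 0 = 0" for x
      using that co(6)[of x] a(5)[of "x 0"] by simp
  qed (rule continuous_on_coord)
  have conta: "continuous_on wave_continuum (\<lambda>x. a (x 0))"
    by (rule continuous_on_compose2[OF a(1)]) (auto intro: continuous_on_coord co)
  show thesis
  proof (rule that[of ?F])
    show "continuous_on wave_continuum ?F" by (rule continuous_on_pt[OF conta contY])
    show "?F ` wave_continuum \<subseteq> wave_continuum"
    proof (rule image_subsetI)
      fix x assume x: "x \<in> wave_continuum"
      have gh: "0 \<le> g (x (Suc 0))" "g (x (Suc 0)) \<le> 1" "0 \<le> h (x (Suc 0))" "h (x (Suc 0)) \<le> 1"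
        using g(2) h(2) co(3,4)[OF x] by (auto simp: image_subset_iff)
      consider "\<bar>x 0\<bar> < 1" | "x 0 = -1" | "x 0 = 1" using co(1,2)[OF x] by linarith
      then show "?F x \<in> wave_continuum"
      proof cases
        case 1
        then have "?Y x = wave (a (x 0))"
          using co(6)[OF x] a(5)[of "x 0"] a(6)[of "x 0"] by auto
        then show ?thesis
          using a(4)[OF 1] wave_bounds[of "a (x 0)"] by (auto simp: mem_wave_continuum)
      qed (use gh a(2,3) in \<open>auto simp: mem_wave_continuum\<close>)
    qed
  qed (simp_all add: a(2,3))
qed

text \<open>In height coordinates, the part of M in the arc is a proper closed subset of [0,1]. Off
  this set the coordinate map of f may be changed so that 0 and 1 are attained.\<close>

lemma end_arc_coordinate_map:
  fixes f :: "(nat \<Rightarrow> real) \<Rightarrow> nat \<Rightarrow> real"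
  assumes "compact M" "\<not> end_arc e \<subseteq> M" "continuous_on (end_arc e) f" "f ` end_arc e \<subseteq> end_arc e'"
  obtains g u v where "continuous_on {0..1} g" "g ` {0..1} \<subseteq> {0..1}"
    "0 \<le> u" "u < v" "v \<le> 1" "g u = 0" "g v = 1"
    "\<forall>y\<in>{0..1}. pt e y \<in> M \<longrightarrow> f (pt e y) = pt e' (g y)"
proof -
  define A where "A = {y \<in> {0..1}. pt e y \<in> M}"
  define \<phi> where "\<phi> y = f (pt e y) (Suc 0)" for y
  have cpt: "continuous_on {0..1} (pt e)"
    using continuous_on_pt[OF continuous_on_const continuous_on_id] by simp
  have fpt: "f (pt e y) = pt e' (\<phi> y)" "0 \<le> \<phi> y" "\<phi> y \<le> 1" if y: "0 \<le> y" "y \<le> 1" for y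
  proof -
    have "pt e y \<in> end_arc e" using y by (auto simp: mem_end_arc)
    then have "f (pt e y) \<in> end_arc e'" using assms(4) by blast
    then show "f (pt e y) = pt e' (\<phi> y)" "0 \<le> \<phi> y" "\<phi> y \<le> 1"
      by (auto simp: \<phi>_def mem_end_arc)
  qed
  have "A = {0..1} \<inter> pt e -` M" by (auto simp: A_def)
  then have "closed A"
    using continuous_closed_preimage[OF cpt closed_atLeastAtMost compact_imp_closed[OF assms(1)]] by simp
  moreover have "A \<subset> {0..1}"
  proof -
    obtain y where "y \<in> {0..1}" "pt e y \<notin> M" using assms(2) unfolding end_arc_def by blast
    then show ?thesis unfolding A_def by blast
  qed
  moreover have "continuous_on {0..1} \<phi>"
  proof -
    have "continuous_on {0..1} (\<lambda>y. f (pt e y))"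
      by (rule continuous_on_compose2[OF assms(3) cpt]) (auto simp: end_arc_def)
    then show ?thesis unfolding \<phi>_def by (rule continuous_on_product_then_coordinatewise)
  qed
  then have "continuous_on A \<phi>" by (rule continuous_on_subset) (auto simp: A_def)
  moreover have "\<phi> ` A \<subseteq> {0..1}" using fpt(2,3) by (auto simp: A_def)
  ultimately obtain g u v where g: "continuous_on {0..1} g" "g ` {0..1} \<subseteq> {0..1}"
    "\<And>x. x \<in> A \<Longrightarrow> g x = \<phi> x" "0 \<le> u" "u < v" "v \<le> 1" "g u = 0" "g v = 1"
    using surjective_modification by metis
  show thesis
    by (rule that[OF g(1,2,4-8)]) (use g(3) fpt(1) in \<open>simp add: A_def\<close>)
qed

lemma path_connected_image_end_arc:
  "continuous_on (end_arc e) f \<Longrightarrow> path_connected (f ` end_arc e)"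
  using path_connected_end_arc path_connected_continuous_image by blast

text \<open>Equal cardinality makes M meet both arcs, so neither arc can be sent into itself and f
  interchanges them. Then M contains neither arc, f can be made surjective on each arc without
  changing it on M, and the interchange extends over the curve.\<close>

lemma minimal_sets_star_subset:
  assumes "M \<in> minimal_sets_star (end_arc (-1)) (end_arc 1)"
  shows "M \<in> minimal_sets wave_continuum"
proof -
  let ?L = "end_arc (-1)" and ?R = "end_arc 1"
  have LR: "?L \<union> ?R \<subseteq> wave_continuum" by (auto simp: wave_continuum_def)
  have disj: "?L \<inter> ?R = {}" using disjnt_end_arcs[of "-1" 1] by (simp add: disjnt_def)
  have eq: "M \<inter> ?L \<approx> M \<inter> ?R" and "M \<in> minimal_sets (?L \<union> ?R)"
    using assms by (auto simp: minimal_sets_star_def)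
  then obtain f where f: "continuous_on (?L \<union> ?R) f" "f ` (?L \<union> ?R) \<subseteq> ?L \<union> ?R"
    and fM: "f ` M = M" "minimal_system M f" and M: "M \<noteq> {}" "compact M" "M \<subseteq> ?L \<union> ?R"
    by (elim minimal_setsE)
  have "M \<inter> ?L = {} \<longleftrightarrow> M \<inter> ?R = {}"
    using eq eqpoll_sym eqpoll_empty_iff_empty by metis
  then have ne: "M \<inter> ?L \<noteq> {}" "M \<inter> ?R \<noteq> {}" using M(1,3) by blast+
  have fL: "continuous_on ?L f" and fR: "continuous_on ?R f"
    by (rule continuous_on_subset[OF f(1)], simp)+
  have side: "f ` end_arc e \<subseteq> ?L \<or> f ` end_arc e \<subseteq> ?R"
    if "end_arc e \<subseteq> ?L \<union> ?R" "continuous_on (end_arc e) f" for e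
  proof -
    have "f ` end_arc e \<subseteq> ?L \<union> ?R" using f(2) that(1) by blast
    \<comment> \<open>The image is path connected inside the curve, so it lies in L as soon as it
      meets L.\<close>
    moreover have "f ` end_arc e \<inter> ?L = {} \<or> f ` end_arc e \<subseteq> ?L"
      using path_connected_meeting_end_arc[OF _ path_connected_image_end_arc[OF that(2)], of "-1"]
        calculation LR by auto
    ultimately show ?thesis by blast
  qed
  have "\<not> f ` ?L \<subseteq> ?L"
  proof
    assume "f ` ?L \<subseteq> ?L"
    then have "M \<subseteq> ?L"
      using minimal_system_subset_closed[OF fM(2) compact_imp_closed[OF compact_end_arc] ne(1)] by blast
    then show False using ne(2) disj by blast
  qed
  then have swL: "f ` ?L \<subseteq> ?R" using side[OF _ fL] by auto
  have "\<not> f ` ?R \<subseteq> ?R"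
  proof
    assume "f ` ?R \<subseteq> ?R"
    then have "M \<subseteq> ?R"
      using minimal_system_subset_closed[OF fM(2) compact_imp_closed[OF compact_end_arc] ne(2)] by blast
    then show False using ne(1) disj by blast
  qed
  then have swR: "f ` ?R \<subseteq> ?L" using side[OF _ fR] by auto
  have notL: "\<not> ?L \<subseteq> M" and notR: "\<not> ?R \<subseteq> M"
    using minimal_not_superset_arc[OF end_arc_homeomorphic f(1) swL swR fM(2)]
      minimal_not_superset_arc[OF end_arc_homeomorphic _ swR swL fM(2)] f(1) by (simp_all add: Un_commute)
  obtain g u v where
    g: "continuous_on {0..1} g" "g ` {0..1} \<subseteq> {0..1}" "0 \<le> u" "u < v" "v \<le> 1" "g u = 0" "g v = 1"
    and gf: "\<forall>y\<in>{0..1}. pt (-1) y \<in> M \<longrightarrow> f (pt (-1) y) = pt 1 (g y)"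
    by (rule end_arc_coordinate_map[OF M(2) notL fL swL])
  obtain h u' v' where
    h: "continuous_on {0..1} h" "h ` {0..1} \<subseteq> {0..1}" "0 \<le> u'" "u' < v'" "v' \<le> 1" "h u' = 0" "h v' = 1"
    and hf: "\<forall>y\<in>{0..1}. pt 1 y \<in> M \<longrightarrow> f (pt 1 y) = pt (-1) (h y)"
    by (rule end_arc_coordinate_map[OF M(2) notR fR swR])
  obtain F where F: "continuous_on wave_continuum F" "F ` wave_continuum \<subseteq> wave_continuum"
    "\<And>y. F (pt (-1) y) = pt 1 (g y)" "\<And>y. F (pt 1 y) = pt (-1) (h y)"
    using wave_swap_extension[OF g h] by metis
  show ?thesis
  proof (rule minimal_setsI[OF fM(2,1) _ F(1,2)])
    show "M \<subseteq> wave_continuum" using M(3) LR by blast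
    show "F x = f x" if "x \<in> M" for x
    proof -
      have "x \<in> ?L \<or> x \<in> ?R" using that M(3) by blast
      then show ?thesis using that gf hf F(3,4) by (auto simp: mem_end_arc)
    qed
  qed
qed

text \<open>The images of the three path-connected pieces each fall into one piece. For M inside a
  single piece f need not preserve that piece, so \<open>minimal_sets_interval\<close> supplies a
  new map; in the interchange case f itself preserves the union of the arcs.\<close>

lemma minimal_sets_wave_continuum_subset:
  assumes "M \<in> minimal_sets wave_continuum"
  shows "M \<in> minimal_sets wave_line \<or> M \<in> minimal_sets (end_arc (-1)) \<or> M \<in> minimal_sets (end_arc 1)
    \<or> M \<in> minimal_sets_star (end_arc (-1)) (end_arc 1)"
proof -
  let ?L = "end_arc (-1)" and ?R = "end_arc 1" and ?X = wave_continuum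
  obtain f where f: "continuous_on ?X f" "f ` ?X \<subseteq> ?X"
    and fM: "f ` M = M" "minimal_system M f" and M: "M \<noteq> {}" "compact M" "M \<subseteq> ?X"
    using assms by (elim minimal_setsE)
  have pieces: "f ` P \<subseteq> ?L \<or> f ` P \<subseteq> wave_line \<or> f ` P \<subseteq> ?R" if P: "path_connected P" "P \<subseteq> ?X" for P
  proof -
    have "path_connected (f ` P)"
      using P continuous_on_subset[OF f(1)] by (intro path_connected_continuous_image) auto
    moreover have "f ` P \<subseteq> ?X" using P(2) f(2) by blast
    ultimately show ?thesis using path_connected_subset_cases by metis
  qed
  have sub: "?L \<subseteq> ?X" "?R \<subseteq> ?X" "wave_line \<subseteq> ?X" by (auto simp: wave_continuum_def)
  have "closure wave_line \<subseteq> ?X"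
    by (rule closure_minimal[OF sub(3) compact_imp_closed[OF compact_wave_continuum]])
  then have dense: "?X = closure wave_line" using wave_continuum_subset_closure by blast
  have disj: "?L \<inter> wave_line = {}" "?R \<inter> wave_line = {}" "?L \<inter> ?R = {}"
    using disjnt_end_arc_wave_line[of "-1"] disjnt_end_arc_wave_line[of 1] disjnt_end_arcs[of "-1" 1]
    by (simp_all add: disjnt_def)
  consider "M \<subseteq> wave_line" | "M \<subseteq> ?L" | "M \<subseteq> ?R"
    | "f ` ?L \<subseteq> ?R" "f ` ?R \<subseteq> ?L" "M \<subseteq> ?L \<union> ?R" "M \<inter> ?L \<noteq> {}" "M \<inter> ?R \<noteq> {}"
    using minimal_set_location[OF f(1) wave_continuum_def disj
      compact_imp_closed[OF compact_end_arc] compact_imp_closed[OF compact_end_arc] dense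
      pieces[OF path_connected_end_arc sub(1)] pieces[OF path_connected_wave_line sub(3)]
      pieces[OF path_connected_end_arc sub(2)] M(3) fM] by metis
  then show ?thesis
  proof cases
    case 1
    then show ?thesis
      using minimal_sets_interval[OF wave_line_homeomorphic _ 1 order_refl assms] by simp
  next
    case 2
    then show ?thesis
      using minimal_sets_interval[OF end_arc_homeomorphic _ 2 order_refl assms] by simp
  next
    case 3
    then show ?thesis
      using minimal_sets_interval[OF end_arc_homeomorphic _ 3 order_refl assms] by simp
  next
    case 4
    have "M \<in> minimal_sets (?L \<union> ?R)"
    proof (rule minimal_setsI[OF fM(2,1) 4(3)])
      show "continuous_on (?L \<union> ?R) f" by (rule continuous_on_subset[OF f(1)]) (use sub in blast)
      show "f ` (?L \<union> ?R) \<subseteq> ?L \<union> ?R" using 4(1,2) by blast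
    qed simp
    moreover have "M \<inter> ?L \<approx> M \<inter> ?R"
      by (rule equinumerous_halves[OF fM(1) 4(3)]) (use 4 disj(3) in \<open>auto simp: disjnt_def\<close>)
    ultimately show ?thesis by (simp add: minimal_sets_star_def)
  qed
qed

theorem mainTheorem6:
  "\<exists>X L J R :: (nat \<Rightarrow> real) set.
     class_C X L J R \<and> is_arc L \<and> is_arc R \<and> disjnt L R \<and>
     is_disjoint_union (minimal_sets X)
       [minimal_sets J, minimal_sets L, minimal_sets R, minimal_sets_star L R]"
proof -
  let ?L = "end_arc (-1)" and ?R = "end_arc 1" and ?X = wave_continuum and ?J = wave_line
  have sub: "?L \<subseteq> ?X" "?R \<subseteq> ?X" "?J \<subseteq> ?X" by (auto simp: wave_continuum_def)
  have mem: "M \<noteq> {}" "M \<subseteq> Y" if "M \<in> minimal_sets Y" for M and Y :: "(nat \<Rightarrow> real) set"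
    using that by (simp_all add: minimal_sets_def)
  have "minimal_sets ?X = minimal_sets ?J \<union> minimal_sets ?L \<union> minimal_sets ?R \<union> minimal_sets_star ?L ?R"
  proof (intro equalityI subsetI)
    fix M assume "M \<in> minimal_sets ?X"
    then show "M \<in> minimal_sets ?J \<union> minimal_sets ?L \<union> minimal_sets ?R \<union> minimal_sets_star ?L ?R"
      using minimal_sets_wave_continuum_subset by blast
  next
    fix M assume "M \<in> minimal_sets ?J \<union> minimal_sets ?L \<union> minimal_sets ?R \<union> minimal_sets_star ?L ?R"
    then consider "M \<in> minimal_sets ?J" | "M \<in> minimal_sets ?L" | "M \<in> minimal_sets ?R"
      | "M \<in> minimal_sets_star ?L ?R" by blast
    then show "M \<in> minimal_sets ?X"
    proof cases
      case 1
      then show ?thesis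
        using minimal_sets_interval[OF wave_line_homeomorphic _ mem(2)[OF 1] sub(3) 1] by simp
    next
      case 2
      then show ?thesis
        using minimal_sets_interval[OF end_arc_homeomorphic _ mem(2)[OF 2] sub(1) 2] by simp
    next
      case 3
      then show ?thesis
        using minimal_sets_interval[OF end_arc_homeomorphic _ mem(2)[OF 3] sub(2) 3] by simp
    next
      case 4
      then show ?thesis by (rule minimal_sets_star_subset)
    qed
  qed
  moreover have "disjnt (minimal_sets Y) (minimal_sets Z)" if "disjnt Y Z"
    for Y Z :: "(nat \<Rightarrow> real) set"
  proof -
    have "M \<notin> minimal_sets Z" if "M \<in> minimal_sets Y" for M
      using mem[of M Y] mem[of M Z] that \<open>disjnt Y Z\<close> unfolding disjnt_iff by blast
    then show ?thesis by (simp add: disjnt_iff)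
  qed
  moreover have star: "M \<inter> ?L \<noteq> {}" "M \<inter> ?R \<noteq> {}" "M \<subseteq> ?L \<union> ?R"
    if "M \<in> minimal_sets_star ?L ?R" for M
  proof -
    have *: "M \<inter> ?L \<approx> M \<inter> ?R" "M \<noteq> {}" "M \<subseteq> ?L \<union> ?R"
      using that mem by (auto simp: minimal_sets_star_def)
    have "M \<inter> ?L = {} \<longleftrightarrow> M \<inter> ?R = {}"
      using *(1) eqpoll_sym eqpoll_empty_iff_empty by metis
    then show "M \<inter> ?L \<noteq> {}" "M \<inter> ?R \<noteq> {}" "M \<subseteq> ?L \<union> ?R" using *(2,3) by blast+
  qed
  have disj: "disjnt ?L ?J" "disjnt ?R ?J" "disjnt ?L ?R"
    by (simp_all add: disjnt_end_arc_wave_line disjnt_end_arcs)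
  \<comment> \<open>A member of the starred system meets both arcs, whereas J, L and R each miss at
    least one of them.\<close>
  have "disjnt (minimal_sets Y) (minimal_sets_star ?L ?R)" if "disjnt ?L Y \<or> disjnt ?R Y"
    for Y :: "(nat \<Rightarrow> real) set"
  proof -
    have "M \<notin> minimal_sets_star ?L ?R" if "M \<in> minimal_sets Y" for M
      using mem(2)[OF that] star[of M] \<open>disjnt ?L Y \<or> disjnt ?R Y\<close> unfolding disjnt_iff by blast
    then show ?thesis by (simp add: disjnt_iff)
  qed
  ultimately have "is_disjoint_union (minimal_sets ?X)
      [minimal_sets ?J, minimal_sets ?L, minimal_sets ?R, minimal_sets_star ?L ?R]"
    using disj by (simp add: is_disjoint_union_def disjnt_sym Un_assoc)
  moreover have "is_arc ?L" "is_arc ?R" by (simp_all add: is_arc_def end_arc_homeomorphic)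
  ultimately show ?thesis using class_C_wave_continuum disj(3) by blast
qed

end
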